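(* Let $d\ge1$, let $a,w_1,\dots,w_d\in\mathbb C$ satisfy $\Re(a)>0$ and $\Re(w_i)>0$ for $i=1,\dots,d$, put $\bm w=(w_1,\dots,w_d)$, and let $q\in\{1,\dots,d\}$. Then $$\begin{aligned} F.P.[\zeta_{\rm B}(\alpha,a|\bm w)]_{\alpha=q}={}&I_{d-q}(q,a|\bm w)\\ &+\frac{(-1)^{d-q}}{\bigl(\prod_{i=1}^dw_i\bigr)(q-1)!}\sum_{k=0}^{d-q}\frac{a^{d-q-k}B_k(\bm w)}{k!\,(d-q-k)!}\bigl(H_{d-q-k}-H_{q-1}-\log a\bigr), \end{aligned}$$ where $$I_M(\alpha,a|\bm w)=\frac{1}{\Gamma(\alpha)}\int_0^\infty {\rm e}^{-at}\left(\frac{t^{\alpha-1}}{\prod_{i=1}^d(1-{\rm e}^{-w_it})}-\frac{t^{\alpha-d-1}}{\prod_{i=1}^dw_i}\sum_{k=0}^M(-1)^kB_k(\bm w)\frac{t^k}{k!}\right){\rm d}t .$$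
   Context: $\log$ is the principal branch on the right half-plane and $z^s=\exp(s\log z)$. $\mathbb N_0=\{0,1,2,\dots\}$, $\bm n\cdot\bm w=\sum_{i=1}^dn_iw_i$. The Barnes zeta function is $\zeta_{\rm B}(\alpha,a|\bm w)=\sum_{\bm n\in\mathbb N_0^d}(a+\bm n\cdot\bm w)^{-\alpha}$ for $\Re(\alpha)>d$; it extends meromorphically in $\alpha$ to $\mathbb C$, with at most simple poles, located at $\alpha=1,\dots,d$. $F.P.[f(\alpha)]_{\alpha=q}$ denotes the constant term of the Laurent expansion of $f$ at $\alpha=q$. Harmonic numbers: $H_k=\sum_{i=1}^k1/i$, $H_0=0$. The higher order Bernoulli polynomials $B_n(x|\bm w)$ are defined by $z^d{\rm e}^{xz}\prod_{i=1}^d\frac{w_i}{{\rm e}^{w_iz}-1}=\sum_{n\ge0}B_n(x|\bm w)\frac{z^n}{n!}$ for $|z|<2\pi/\max_i|w_i|$, and the higher order Bernoulli numbers are $B_k(\bm w)=B_k(0|\bm w)$. *)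

theory Defs
  imports "HOL-Complex_Analysis.Complex_Analysis"
begin

(* A vector w = (w_1, ..., w_d) is a function on nat, of which only the values on {1..d} are used. *)

(* "powr" and "ln" on complex are the principal branches. *)
definition barnes_series :: "nat \<Rightarrow> complex \<Rightarrow> complex \<Rightarrow> (nat \<Rightarrow> complex) \<Rightarrow> complex" where
  "barnes_series d \<alpha> a w =
     (\<Sum>\<^sub>\<infinity>n \<in> {1..d} \<rightarrow>\<^sub>E (UNIV :: nat set). (a + (\<Sum>i=1..d. of_nat (n i) * w i)) powr (- \<alpha>))"

(* The meromorphic continuation of the series. "Nicely" means that removable singularities are
   removed and that the value at a pole is 0; this makes the continuation unique as a function. *)
definition barnes_zeta :: "nat \<Rightarrow> complex \<Rightarrow> complex \<Rightarrow> (nat \<Rightarrow> complex) \<Rightarrow> complex" where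
  "barnes_zeta d \<alpha> a w =
     (THE f. f nicely_meromorphic_on UNIV \<and>
             (\<forall>s. Re s > real d \<longrightarrow> f s = barnes_series d s a w)) \<alpha>"

definition finite_part :: "(complex \<Rightarrow> complex) \<Rightarrow> complex \<Rightarrow> complex" where
  "finite_part f q = fls_nth (laurent_expansion f q) 0"

(* The generating function has a removable singularity at 0, where the formula as written takes
   a junk value (division by 0), hence the exclusion of z = 0. *)
definition bernoulli_poly_ho :: "nat \<Rightarrow> nat \<Rightarrow> complex \<Rightarrow> (nat \<Rightarrow> complex) \<Rightarrow> complex" where
  "bernoulli_poly_ho d n x w =
     (THE B :: nat \<Rightarrow> complex.
        \<forall>z. z \<noteq> 0 \<and> (\<forall>i\<in>{1..d}. norm z * norm (w i) < 2 * pi) \<longrightarrow>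
          (\<lambda>k. B k * z ^ k / fact k) sums
            (z ^ d * exp (x * z) * (\<Prod>i=1..d. w i / (exp (w i * z) - 1)))) n"

definition bernoulli_num_ho :: "nat \<Rightarrow> nat \<Rightarrow> (nat \<Rightarrow> complex) \<Rightarrow> complex" where
  "bernoulli_num_ho d k w = bernoulli_poly_ho d k 0 w"

definition barnes_I :: "nat \<Rightarrow> nat \<Rightarrow> complex \<Rightarrow> complex \<Rightarrow> (nat \<Rightarrow> complex) \<Rightarrow> complex" where
  "barnes_I d M \<alpha> a w =
     1 / Gamma \<alpha> *
     (LINT t:{0<..}|lborel.
        exp (- a * of_real t) *
        (of_real t powr (\<alpha> - 1) / (\<Prod>i=1..d. 1 - exp (- w i * of_real t))
         - of_real t powr (\<alpha> - of_nat d - 1) / (\<Prod>i=1..d. w i) *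
           (\<Sum>k=0..M. (-1) ^ k * bernoulli_num_ho d k w * of_real t ^ k / fact k)))"

end

theory Submission
  imports Defs
begin

text \<open>
  Put \<open>T t = (\<Prod>i. t / (1 - exp (- w\<^sub>i * t)))\<close>, whose Taylor coefficients at 0 are \<open>b\<^sub>k = (-1)\<^sup>k B\<^sub>k(w) / (k! \<Prod>i. w\<^sub>i)\<close>,
  and let \<open>T\<^sub>N\<close> be \<open>T\<close> minus its Taylor polynomial of degree less than \<open>N\<close>. For \<open>Re s > d\<close> the Barnes series is the
  Mellin transform \<open>1 / Gamma s * (\<integral>t. exp (- a t) t powr (s - d - 1) T t)\<close>. Splitting off the term \<open>b\<^sub>k t\<^sup>k\<close> costs
  \<open>b\<^sub>k Gamma (s - d + k) / Gamma s * a powr (d - k - s)\<close>, in which the quotient of Gamma values is a rational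
  function of \<open>s\<close>, and makes the remaining integral converge on a half-plane larger by one. This continues
  the series to \<open>Re s > d - N\<close> for every \<open>N\<close>. With \<open>N = d - q + 1\<close> the integral is analytic at \<open>q\<close> and every
  split-off term has a simple pole there, so the finite part is the derivative at \<open>q\<close> of \<open>(s - q)\<close> times the
  continuation; the harmonic numbers are the logarithmic derivatives of the rational factors.
\<close>

section \<open>Integrals over the positive half-line depending on a complex parameter\<close>

text \<open>On compact subintervals of the half-line the Leibniz rule gives holomorphy. The local
  majorant \<open>g\<close> makes the truncated integrals converge uniformly near each
  \<open>s\<close>, and locally uniform limits of holomorphic functions are holomorphic.\<close>

lemma holomorphic_on_set_integral_Ioi:
  fixes f f' :: "complex \<Rightarrow> real \<Rightarrow> complex"
  assumes deriv: "\<And>s t. s \<in> U \<Longrightarrow> t > 0 \<Longrightarrow> ((\<lambda>s. f s t) has_field_derivative f' s t) (at s)"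
    and cont: "\<And>s. s \<in> U \<Longrightarrow> continuous_on {0<..} (f s)"
    and cont': "continuous_on (U \<times> {0<..}) (\<lambda>(s, t). f' s t)"
    and dom: "\<And>s. s \<in> U \<Longrightarrow> \<exists>r>0. \<exists>g. ball s r \<subseteq> U \<and> set_integrable lborel {0<..} g \<and>
                (\<forall>z\<in>ball s r. \<forall>t>0. norm (f z t) \<le> (g t :: real))"
  shows "(\<lambda>s. LINT t:{0<..}|lborel. f s t) holomorphic_on U"
proof (rule analytic_imp_holomorphic, unfold analytic_on_def, rule ballI)
  fix s assume "s \<in> U"
  then obtain r g where r: "r > 0" "ball s r \<subseteq> U" and g: "set_integrable lborel {0<..} g"
    and bound: "\<And>z t. z \<in> ball s r \<Longrightarrow> t > 0 \<Longrightarrow> norm (f z t) \<le> g t"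
    using dom by meson
  \<comment> \<open>A compact exhaustion that stays away from 0, where \<open>f s\<close> may be
    singular.\<close>
  define K where "K n = {1 / (real n + 1)..real n + 1}" for n
  have K_sub: "K n \<subseteq> {0<..}" for n
    by (auto simp: K_def intro: less_le_trans[rotated])
  have "incseq K"
    unfolding K_def incseq_def by (auto simp: frac_le intro: order.trans[OF _])
  have K_UN: "(\<Union>n. K n) = {0<..}"
  proof
    show "(\<Union>n. K n) \<subseteq> {0<..}" using K_sub by blast
  next
    show "{0<..} \<subseteq> (\<Union>n. K n)"
    proof
      fix t :: real assume "t \<in> {0<..}"
      hence t: "t > 0" by simp
      obtain n where n: "real n > max t (1 / t)" using reals_Archimedean2 by blast
      hence "1 / t \<le> real n + 1" by simp
      hence "1 / (real n + 1) \<le> t" using t by (simp add: field_simps)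
      thus "t \<in> (\<Union>n. K n)" using n by (auto simp: K_def intro!: exI[of _ n])
    qed
  qed
  have int_f: "set_integrable lborel {0<..} (f z)" if "z \<in> ball s r" for z
  proof (rule set_integrable_bound[OF g])
    show "set_borel_measurable lborel {0<..} (f z)"
      using cont[of z] that r borel_measurable_continuous_on_indicator[of "{0<..}" "f z"]
      by (auto simp: set_borel_measurable_def)
    show "AE t in lborel. t \<in> {0<..} \<longrightarrow> norm (f z t) \<le> norm (g t)"
      using bound[OF that] by (auto intro!: AE_I2 order.trans[OF _ abs_ge_self])
  qed
  have int_fK: "set_integrable lborel (K n) (f z)" if "z \<in> ball s r" for z n
    using set_integrable_subset[OF int_f[OF that] _ K_sub] by (simp add: K_def)
  have int_gK: "set_integrable lborel (K n) g" for n
    using set_integrable_subset[OF g _ K_sub] by (simp add: K_def)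
  have lim: "(\<lambda>n. LINT t:K n|lborel. g t) \<longlonglongrightarrow> (LINT t:{0<..}|lborel. g t)"
    using set_integral_cont_up[of K lborel g] \<open>incseq K\<close> g K_UN by (simp add: K_def)
  \<comment> \<open>The error is the integral of \<open>f z\<close> over the complement of
    \<open>K n\<close>. It is at most the tail of the integral of \<open>g\<close> there, which does
    not depend on \<open>z\<close>.\<close>
  have uniform: "uniform_limit (ball s r) (\<lambda>n z. integral (K n) (f z))
           (\<lambda>z. LINT t:{0<..}|lborel. f z t) sequentially"
  proof (rule uniform_limitI)
    fix e :: real assume "e > 0"
    have "eventually (\<lambda>n. dist (LINT t:K n|lborel. g t) (LINT t:{0<..}|lborel. g t) < e) sequentially"
      using lim \<open>e > 0\<close> by (rule tendstoD)
    thus "\<forall>\<^sub>F n in sequentially. \<forall>z\<in>ball s r.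
            dist (integral (K n) (f z)) (LINT t:{0<..}|lborel. f z t) < e"
    proof eventually_elim
      case (elim n)
      have split: "{0<..} = K n \<union> ({0<..} - K n)" using K_sub by auto
      have m [measurable]: "{0<..} - K n \<in> sets lborel" "K n \<in> sets lborel" by (auto simp: K_def)
      show ?case
      proof
        fix z assume z: "z \<in> ball s r"
        have f2: "set_integrable lborel ({0<..} - K n) (f z)"
          by (rule set_integrable_subset[OF int_f[OF z] m(1)]) auto
        have g2: "set_integrable lborel ({0<..} - K n) g"
          by (rule set_integrable_subset[OF g m(1)]) auto
        have "(LINT t:{0<..}|lborel. f z t) = (LINT t:K n|lborel. f z t) + (LINT t:{0<..} - K n|lborel. f z t)"
          by (subst split, rule set_integral_Un) (auto intro: int_fK[OF z] f2)
        moreover have "(LINT t:{0<..}|lborel. g t) = (LINT t:K n|lborel. g t) + (LINT t:{0<..} - K n|lborel. g t)"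
          by (subst split, rule set_integral_Un) (auto intro: int_gK g2)
        moreover have "norm (LINT t:{0<..} - K n|lborel. f z t) \<le> (LINT t:{0<..} - K n|lborel. g t)"
        proof -
          have "norm (LINT t:{0<..} - K n|lborel. f z t) \<le> (LINT t:{0<..} - K n|lborel. norm (f z t))"
            by (rule set_integral_norm_bound[OF f2])
          also have "\<dots> \<le> (LINT t:{0<..} - K n|lborel. g t)"
            by (rule set_integral_mono[OF set_integrable_norm[OF f2] g2]) (auto intro: bound[OF z])
          finally show ?thesis .
        qed
        moreover have "integral (K n) (f z) = (LINT t:K n|lborel. f z t)"
          using set_borel_integral_eq_integral(2)[OF int_fK[OF z]] by simp
        ultimately show "dist (integral (K n) (f z)) (LINT t:{0<..}|lborel. f z t) < e"
          using elim by (simp add: dist_norm norm_minus_commute)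
      qed
    qed
  qed
  have "(\<lambda>z. LINT t:{0<..}|lborel. f z t) holomorphic_on ball s r"
  proof (rule holomorphic_uniform_sequence[where f = "\<lambda>n z. integral (K n) (f z)"])
    show "(\<lambda>z. integral (K n) (f z)) holomorphic_on ball s r" for n
    proof -
      have "(\<lambda>z. integral (cbox (1 / (real n + 1)) (real n + 1)) (f z)) holomorphic_on ball s r"
      proof (rule leibniz_rule_holomorphic[where fx = f'])
        fix z t assume zt: "z \<in> ball s r" "t \<in> cbox (1 / (real n + 1)) (real n + 1)"
        have "t > 0" using zt(2) K_sub[of n] by (auto simp: K_def)
        thus "((\<lambda>z. f z t) has_field_derivative f' z t) (at z within ball s r)"
          by (rule has_field_derivative_at_within[OF deriv[OF subsetD[OF r(2) zt(1)]]])
      next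
        fix z assume "z \<in> ball s r"
        thus "f z integrable_on cbox (1 / (real n + 1)) (real n + 1)"
          using set_borel_integral_eq_integral(1)[OF int_fK[of z n]] by (simp add: K_def)
      next
        show "continuous_on (ball s r \<times> cbox (1 / (real n + 1)) (real n + 1)) (\<lambda>(z, t). f' z t)"
          by (rule continuous_on_subset[OF cont']) (use r K_sub[of n] in \<open>auto simp: K_def\<close>)
      qed auto
      thus ?thesis by (simp add: K_def)
    qed
  next
    fix x assume "x \<in> ball s r"
    then obtain \<delta> where "\<delta> > 0" "cball x \<delta> \<subseteq> ball s r"
      using open_contains_cball[of "ball s r"] by blast
    thus "\<exists>\<delta>. 0 < \<delta> \<and> cball x \<delta> \<subseteq> ball s r \<and>
           uniform_limit (cball x \<delta>) (\<lambda>n z. integral (K n) (f z)) (\<lambda>z. LINT t:{0<..}|lborel. f z t) sequentially"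
      using uniform_limit_on_subset[OF uniform] by blast
  qed auto
  thus "\<exists>e>0. (\<lambda>z. LINT t:{0<..}|lborel. f z t) holomorphic_on ball s e"
    using r by blast
qed

section \<open>Gamma integrals with a complex rate\<close>

lemma norm_powr_times_exp:
  fixes s \<mu> :: complex and t :: real
  assumes "t > 0"
  shows "norm (of_real t powr s * exp (- \<mu> * of_real t)) = t powr Re s * exp (- Re \<mu> * t)"
  using assms by (simp add: norm_mult norm_powr_real_powr)

lemma set_integrable_powr_exp:
  fixes x c :: real
  assumes "x > -1" "c > 0"
  shows "set_integrable lborel {0<..} (\<lambda>t. t powr x * exp (- c * t))"
proof -
  have "(\<lambda>t. complex_of_real t powr (of_real (x + 1) - 1) / of_real (exp (c * t))) absolutely_integrable_on {0<..}"
    by (rule absolutely_integrable_Gamma_integral) (use assms in auto)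
  hence "(\<lambda>t. norm (complex_of_real t powr (of_real (x + 1) - 1) / of_real (exp (c * t)))) absolutely_integrable_on {0<..}"
    by (rule absolutely_integrable_norm[unfolded o_def])
  hence "(\<lambda>t. t powr x * exp (- c * t)) absolutely_integrable_on {0<..}"
    by (rule set_integrable_cong[THEN iffD1, rotated -1])
       (auto simp: norm_divide norm_powr_real_powr exp_minus field_simps)
  \<comment> \<open>The Gamma integral is stated for the completed Lebesgue measure; since the
    integrand is Borel measurable, integrability passes to \<open>lborel\<close>.\<close>
  thus ?thesis
    unfolding set_integrable_def by (subst (asm) integrable_completion) auto
qed

lemma continuous_on_powr_times_exp:
  "continuous_on {0<..} (\<lambda>t::real. of_real t powr s * exp (- \<mu> * of_real t) :: complex)"
  by (intro continuous_intros) (auto simp: complex_nonpos_Reals_iff)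

lemma set_integrable_complex_powr_exp:
  fixes s \<mu> :: complex
  assumes "Re s > 0" "Re \<mu> > 0"
  shows "set_integrable lborel {0<..} (\<lambda>t. of_real t powr (s - 1) * exp (- \<mu> * of_real t))"
proof (rule set_integrable_bound)
  show "set_integrable lborel {0<..} (\<lambda>t. t powr (Re s - 1) * exp (- Re \<mu> * t))"
    by (rule set_integrable_powr_exp) (use assms in auto)
  show "set_borel_measurable lborel {0<..} (\<lambda>t. of_real t powr (s - 1) * exp (- \<mu> * of_real t))"
    using borel_measurable_continuous_on_indicator[OF _ continuous_on_powr_times_exp]
    by (simp add: set_borel_measurable_def)
  show "AE t in lborel. t \<in> {0<..} \<longrightarrow> norm (of_real t powr (s - 1) * exp (- \<mu> * of_real t))
          \<le> norm (t powr (Re s - 1) * exp (- Re \<mu> * t))"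
    by (intro AE_I2 impI) (subst norm_powr_times_exp, auto)
qed

text \<open>Substituting \<open>c * t\<close> for \<open>t\<close> in Euler's integral, which is the
  case of rate 1.\<close>

lemma Gamma_integral_real_rate:
  fixes s :: complex and c :: real
  assumes s: "Re s > 0" and c: "c > 0"
  shows "(LINT t:{0<..}|lborel. of_real t powr (s - 1) * exp (- of_real c * of_real t)) =
           Gamma s * of_real c powr (- s)"
proof -
  define h where "h c t = complex_of_real t powr (s - 1) * exp (- of_real c * of_real t)" for c t
  have "(LINT t:{0<..}|lborel. h 1 t) = integral {0<..} (h 1)"
    unfolding h_def using set_integrable_complex_powr_exp[OF s, of 1]
    by (intro set_borel_integral_eq_integral) simp
  also have "\<dots> = Gamma s"
    by (intro integral_unique has_integral_eq[OF _ Gamma_integral_complex'[OF s]])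
       (simp add: h_def exp_minus field_simps exp_of_real)
  finally have 1: "(LINT t:{0<..}|lborel. h 1 t) = Gamma s" .
  have "Gamma s = (\<integral>t. indicator {0<..} t *\<^sub>R h 1 t \<partial>lborel)"
    using 1 by (simp add: set_lebesgue_integral_def)
  also have "\<dots> = c *\<^sub>R (\<integral>t. indicator {0<..} (c * t) *\<^sub>R h 1 (c * t) \<partial>lborel)"
    using lborel_integral_real_affine[of c "\<lambda>t. indicator {0<..} t *\<^sub>R h 1 t" 0] c by simp
  also have "(\<lambda>t. indicator {0<..} (c * t) *\<^sub>R h 1 (c * t)) =
             (\<lambda>t. of_real c powr (s - 1) * (indicator {0<..} t *\<^sub>R h c t))"
  proof
    fix t show "indicator {0<..} (c * t) *\<^sub>R h 1 (c * t) =
             of_real c powr (s - 1) * (indicator {0<..} t *\<^sub>R h c t)"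
      using c by (cases "t > 0") (auto simp: h_def indicator_def zero_less_mult_iff powr_times_real)
  qed
  also have "(\<integral>t. of_real c powr (s - 1) * (indicator {0<..} t *\<^sub>R h c t) \<partial>lborel) =
             of_real c powr (s - 1) * (LINT t:{0<..}|lborel. h c t)"
    unfolding set_lebesgue_integral_def by (rule integral_mult_right_zero)
  finally have "Gamma s = of_real c * of_real c powr (s - 1) * (LINT t:{0<..}|lborel. h c t)"
    by (simp add: scaleR_conv_of_real)
  also have "of_real c * of_real c powr (s - 1) = complex_of_real c powr s"
    using c by (simp add: powr_diff)
  finally show ?thesis
    using c by (simp add: h_def powr_minus field_simps)
qed

text \<open>Both sides are holomorphic in \<mu> on the right half-plane and agree on the positive
  reals, so the identity theorem replaces a rotation of the contour.\<close>

lemma Gamma_integral_complex_rate: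
  fixes s \<mu> :: complex
  assumes s: "Re s > 0" and \<mu>: "Re \<mu> > 0"
  shows "(LINT t:{0<..}|lborel. of_real t powr (s - 1) * exp (- \<mu> * of_real t)) =
           Gamma s * \<mu> powr (- s)"
proof -
  define H where "H = {z :: complex. Re z > 0}"
  define I where "I z = (LINT t:{0<..}|lborel. of_real t powr (s - 1) * exp (- z * of_real t))" for z
  have "open H" "convex H"
    unfolding H_def by (simp_all add: open_halfspace_Re_gt convex_halfspace_Re_gt)
  have "I holomorphic_on H"
    unfolding I_def
  proof (rule holomorphic_on_set_integral_Ioi[where
        f' = "\<lambda>z t. - of_real t * of_real t powr (s - 1) * exp (- z * of_real t)"])
    fix z t show "((\<lambda>z. of_real t powr (s - 1) * exp (- z * of_real t)) has_field_derivative
             - of_real t * of_real t powr (s - 1) * exp (- z * of_real t)) (at z)"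
      by (auto intro!: derivative_eq_intros)
  next
    show "continuous_on (H \<times> {0<..}) (\<lambda>(z, t). - of_real t * of_real t powr (s - 1) * exp (- z * of_real t))"
      unfolding case_prod_unfold
      by (intro continuous_intros) (auto simp: complex_nonpos_Reals_iff)
  next
    fix z assume z: "z \<in> H"
    \<comment> \<open>Half the distance to the imaginary axis: on the ball the real part stays at
      least \<rho>, so the integrand with rate \<rho> is a majorant.\<close>
    define \<rho> where "\<rho> = Re z / 2"
    have \<rho>: "\<rho> > 0" using z by (simp add: \<rho>_def H_def)
    have Re_ge: "Re z' \<ge> \<rho>" if "z' \<in> ball z \<rho>" for z'
      using abs_Re_le_cmod[of "z - z'"] that by (auto simp: dist_norm \<rho>_def)
    have "set_integrable lborel {0<..} (\<lambda>t. t powr (Re s - 1) * exp (- \<rho> * t))"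
      by (rule set_integrable_powr_exp) (use s \<rho> in auto)
    moreover have "norm (of_real t powr (s - 1) * exp (- z' * of_real t)) \<le> t powr (Re s - 1) * exp (- \<rho> * t)"
      if "z' \<in> ball z \<rho>" "t > 0" for z' t
      by (subst norm_powr_times_exp) (use that Re_ge[OF that(1)] in auto)
    ultimately show "\<exists>r>0. \<exists>g. ball z r \<subseteq> H \<and> set_integrable lborel {0<..} g \<and>
        (\<forall>z'\<in>ball z r. \<forall>t>0. norm (of_real t powr (s - 1) * exp (- z' * of_real t)) \<le> g t)"
      using \<rho> Re_ge by (intro exI[of _ \<rho>] conjI exI[of _ "\<lambda>t. t powr (Re s - 1) * exp (- \<rho> * t)"])
        (fastforce simp: H_def)+
  qed (rule continuous_on_powr_times_exp)
  hence hol: "(\<lambda>z. I z - Gamma s * z powr (- s)) holomorphic_on H"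
    by (intro holomorphic_intros) (auto simp: H_def complex_nonpos_Reals_iff)
  have "(\<lambda>z. I z - Gamma s * z powr (- s)) \<mu> = 0"
  proof (rule analytic_continuation[OF hol \<open>open H\<close>, where U = "complex_of_real ` {0<..}" and \<xi> = 1])
    show "(1::complex) islimpt complex_of_real ` {0<..}"
      unfolding islimpt_approachable
    proof safe
      fix e :: real assume "e > 0"
      thus "\<exists>x'\<in>complex_of_real ` {0<..}. x' \<noteq> 1 \<and> dist x' 1 < e"
        by (intro bexI[of _ "complex_of_real (1 + e / 2)"] imageI) (auto simp: dist_norm)
    qed
    show "I z - Gamma s * z powr (- s) = 0" if "z \<in> complex_of_real ` {0<..}" for z
      using that Gamma_integral_real_rate[OF s] by (auto simp: I_def)
  qed (use \<mu> \<open>convex H\<close> in \<open>auto simp: H_def intro: convex_connected\<close>)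
  thus ?thesis by (simp add: I_def)
qed

section \<open>Bernoulli numbers and the Mellin kernel\<close>

text \<open>The entire extension of \<open>(exp z - 1) / z\<close>.\<close>

definition exp_quotient :: "complex \<Rightarrow> complex" where
  "exp_quotient z = (if z = 0 then 1 else (exp z - 1) / z)"

lemma holomorphic_exp_quotient: "exp_quotient holomorphic_on UNIV"
proof -
  have "(\<lambda>z. if z = 0 then deriv exp 0 else (exp z - exp 0) / (z - 0)) holomorphic_on (UNIV :: complex set)"
    by (rule pole_lemma_open) (auto intro: holomorphic_intros)
  moreover have "deriv exp (0 :: complex) = 1"
    using DERIV_imp_deriv[OF DERIV_exp[of "0::complex"]] by simp
  ultimately show ?thesis
    by (simp add: exp_quotient_def[abs_def] cong: if_cong)
qed

text \<open>The zeros of \<open>exp z - 1\<close> are the integer multiples of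
  \<open>2 * pi * i\<close>; the one at 0 is removed by the quotient, and the next ones have modulus
  \<open>2 * pi\<close>.\<close>

lemma exp_quotient_nonzero:
  assumes "norm z < 2 * pi"
  shows "exp_quotient z \<noteq> 0"
proof
  assume "exp_quotient z = 0"
  hence z: "z \<noteq> 0" "exp z = 1"
    by (auto simp: exp_quotient_def split: if_splits)
  from z(2) obtain n :: int where n: "Re z = 0" "Im z = of_int (2 * n) * pi"
    by (auto simp: exp_eq_1)
  with z(1) have "n \<noteq> 0" by (auto simp: complex_eq_iff)
  hence "\<bar>real_of_int n\<bar> \<ge> 1" by linarith
  hence "\<bar>Im z\<bar> \<ge> 2 * pi" using n by (simp add: abs_mult)
  with abs_Im_le_cmod[of z] assms show False by linarith
qed

text \<open>The generating function of the Bernoulli numbers with its removable singularity at 0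
  filled in.\<close>

definition bernoulli_gf :: "nat \<Rightarrow> (nat \<Rightarrow> complex) \<Rightarrow> complex \<Rightarrow> complex" where
  "bernoulli_gf d w z = (\<Prod>i=1..d. 1 / exp_quotient (w i * z))"

lemma bernoulli_gf_eq:
  assumes "z \<noteq> 0" "\<And>i. i \<in> {1..d} \<Longrightarrow> w i \<noteq> 0"
  shows "bernoulli_gf d w z = z ^ d * (\<Prod>i=1..d. w i / (exp (w i * z) - 1))"
proof -
  have "bernoulli_gf d w z = (\<Prod>i=1..d. z * (w i / (exp (w i * z) - 1)))"
    unfolding bernoulli_gf_def
    by (intro prod.cong refl) (use assms in \<open>auto simp: exp_quotient_def\<close>)
  thus ?thesis by (simp only: prod.distrib prod_constant card_atLeastAtMost) simp
qed

text \<open>Resolves the definite description behind the Bernoulli numbers: the Taylor series of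
  \<open>bernoulli_gf\<close> at 0 gives existence, uniqueness of Laurent expansions gives
  uniqueness. The expansion then also holds at \<open>z = 0\<close>, which the description leaves
  out.\<close>

lemma bernoulli_num_ho_sums:
  assumes d: "d \<ge> 1" and w: "\<And>i. i \<in> {1..d} \<Longrightarrow> w i \<noteq> 0"
    and z: "\<And>i. i \<in> {1..d} \<Longrightarrow> norm z * norm (w i) < 2 * pi"
  shows "(\<lambda>k. bernoulli_num_ho d k w * z ^ k / fact k) sums bernoulli_gf d w z"
proof -
  define S where "S = {z :: complex. \<forall>i\<in>{1..d}. norm z * norm (w i) < 2 * pi}"
  define r where "r = Min ((\<lambda>i. 2 * pi / norm (w i)) ` {1..d})"
  have S: "S = ball 0 r"
    unfolding S_def r_def using d w by (auto simp: field_simps)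
  have r: "r > 0"
    unfolding r_def using d w by (subst Min_gr_iff) auto
  have hol: "bernoulli_gf d w holomorphic_on ball 0 r"
    unfolding bernoulli_gf_def
  proof (intro holomorphic_intros)
    fix i assume i: "i \<in> {1..d}"
    show "(\<lambda>z. exp_quotient (w i * z)) holomorphic_on ball 0 r"
      using holomorphic_on_compose[of "\<lambda>z. w i * z" "ball 0 r" exp_quotient] holomorphic_exp_quotient
      by (auto simp: o_def intro!: holomorphic_intros intro: holomorphic_on_subset)
    show "exp_quotient (w i * z) \<noteq> 0" if "z \<in> ball 0 r" for z
    proof (rule exp_quotient_nonzero)
      have "z \<in> S" using that S by simp
      hence "norm z * norm (w i) < 2 * pi" using i unfolding S_def by blast
      thus "norm (w i * z) < 2 * pi" by (simp add: norm_mult mult.commute[of "norm (w i)"])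
    qed
  qed
  define P where "P B \<longleftrightarrow> (\<forall>z. z \<noteq> 0 \<and> (\<forall>i\<in>{1..d}. norm z * norm (w i) < 2 * pi) \<longrightarrow>
      (\<lambda>k. B k * z ^ k / fact k) sums
        (z ^ d * exp (0 * z) * (\<Prod>i=1..d. w i / (exp (w i * z) - 1))))" for B :: "nat \<Rightarrow> complex"
  have P_iff: "P B \<longleftrightarrow> (\<forall>z. z \<noteq> 0 \<and> z \<in> S \<longrightarrow> (\<lambda>k. B k / fact k * z ^ k) sums bernoulli_gf d w z)" for B
    unfolding P_def S_def mem_Collect_eq using bernoulli_gf_eq[of _ d w, OF _ w] by simp
  define B0 where "B0 n = (deriv ^^ n) (bernoulli_gf d w) 0" for n
  have B0: "(\<lambda>k. B0 k / fact k * z ^ k) sums bernoulli_gf d w z" if "z \<in> S" for z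
    using holomorphic_power_series[OF hol, of z] that by (simp add: B0_def S)
  \<comment> \<open>The description speaks about a punctured disc only, so sequences are compared
    through Laurent expansions, which ignore the value at 0.\<close>
  have expansion: "bernoulli_gf d w has_laurent_expansion fps_to_fls (Abs_fps (\<lambda>k. B k / fact k))"
    if "P B" for B
  proof -
    let ?F = "Abs_fps (\<lambda>k. B k / fact k)"
    \<comment> \<open>Convergence at a single nonzero point already bounds the radius of convergence
      from below.\<close>
    have "complex_of_real (r / 2) \<in> S" "complex_of_real (r / 2) \<noteq> 0"
      using r by (auto simp: S)
    with that have "summable (\<lambda>k. B k / fact k * complex_of_real (r / 2) ^ k)"
      unfolding P_iff by (metis sums_summable)
    from conv_radius_geI[OF this] have radius: "ereal (r / 2) \<le> fps_conv_radius ?F"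
      using r by (simp add: fps_conv_radius_def)
    moreover have "0 < ereal (r / 2)" using r by simp
    ultimately have "0 < fps_conv_radius ?F"
      by (rule less_le_trans[rotated])
    moreover have "eventually (\<lambda>z. z \<in> ball 0 (r / 2) - {0}) (at (0::complex))"
      using r by (intro eventually_at_in_open) auto
    hence "\<forall>\<^sub>F z in at 0. eval_fls (fps_to_fls ?F) z = bernoulli_gf d w z"
    proof eventually_elim
      case (elim z)
      hence "z \<in> S" "z \<noteq> 0" using r by (auto simp: S)
      moreover have "ereal (norm z) < fps_conv_radius ?F"
        by (rule less_le_trans[OF _ radius]) (use elim in simp)
      moreover have "(\<lambda>k. B k / fact k * z ^ k) sums bernoulli_gf d w z"
        using \<open>P B\<close> \<open>z \<in> S\<close> \<open>z \<noteq> 0\<close> unfolding P_iff by blast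
      ultimately show ?case by (subst eval_fps_to_fls) (simp_all add: eval_fps_def sums_iff)
    qed
    ultimately show ?thesis
      unfolding has_laurent_expansion_def fls_conv_radius_fps_to_fls by blast
  qed
  have "P B0" using B0 by (simp add: P_iff)
  moreover have "B = B0" if "P B" for B
  proof
    fix n
    have "Abs_fps (\<lambda>k. B k / fact k) = Abs_fps (\<lambda>k. B0 k / fact k)"
      using has_laurent_expansion_unique[OF expansion[OF that] expansion[OF \<open>P B0\<close>]] by simp
    thus "B n = B0 n" by (simp add: fps_eq_iff)
  qed
  ultimately have "(THE B. P B) = B0" by (rule the_equality)
  hence "bernoulli_num_ho d k w = B0 k" for k
    by (simp add: bernoulli_num_ho_def bernoulli_poly_ho_def P_def)
  thus ?thesis using B0[of z] z by (simp add: S_def)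
qed


section \<open>Taylor expansion and growth of the Mellin kernel\<close>

definition barnes_coeff :: "nat \<Rightarrow> (nat \<Rightarrow> complex) \<Rightarrow> nat \<Rightarrow> complex" where
  "barnes_coeff d w k = (-1) ^ k * bernoulli_num_ho d k w / (fact k * (\<Prod>i=1..d. w i))"

text \<open>The factor \<open>t\<close> in each numerator cancels the pole at 0, so the kernel stays
  bounded as \<open>t\<close> tends to 0. Only \<open>t > 0\<close> is of interest: at 0 itself
  division by zero gives a meaningless value.\<close>

definition barnes_kernel :: "nat \<Rightarrow> (nat \<Rightarrow> complex) \<Rightarrow> real \<Rightarrow> complex" where
  "barnes_kernel d w t = (\<Prod>i=1..d. of_real t / (1 - exp (- w i * of_real t)))"

definition barnes_tail :: "nat \<Rightarrow> nat \<Rightarrow> (nat \<Rightarrow> complex) \<Rightarrow> real \<Rightarrow> complex" where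
  "barnes_tail d N w t = barnes_kernel d w t - (\<Sum>k<N. barnes_coeff d w k * of_real t ^ k)"

lemma norm_exp_less_1:
  assumes "Re w > 0" "t > 0"
  shows "norm (exp (- w * of_real t)) < 1"
  using assms by simp

lemma one_minus_exp_nonzero:
  assumes "Re w > 0" "t > 0"
  shows "1 - exp (- w * of_real t) \<noteq> 0"
  using norm_exp_less_1[OF assms] by (metis eq_iff_diff_eq_0 less_irrefl norm_one)

lemma barnes_kernel_eq:
  assumes "\<And>i. i \<in> {1..d} \<Longrightarrow> w i \<noteq> 0" "t \<noteq> 0"
  shows "barnes_kernel d w t = bernoulli_gf d w (- of_real t) / (\<Prod>i=1..d. w i)"
  unfolding barnes_kernel_def bernoulli_gf_def prod_dividef[symmetric]
proof (intro prod.cong refl)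
  fix i assume i: "i \<in> {1..d}"
  have "complex_of_real t / (1 - exp (- (w i * of_real t))) = - (of_real t / (exp (- (w i * of_real t)) - 1))"
    by (metis minus_diff_eq minus_divide_right)
  thus "of_real t / (1 - exp (- w i * of_real t)) = 1 / exp_quotient (w i * - of_real t) / w i"
    using assms(1)[OF i] assms(2) by (simp add: exp_quotient_def)
qed

text \<open>The kernel is the generating function at \<open>- t\<close> divided by the product of
  the \<open>w i\<close>; the argument \<open>- t\<close> is the source of the sign in
  \<open>barnes_coeff\<close>.\<close>

lemma barnes_kernel_sums:
  assumes d: "d \<ge> 1" and w: "\<And>i. i \<in> {1..d} \<Longrightarrow> w i \<noteq> 0"
  shows "\<exists>r>0. \<forall>t. 0 < t \<longrightarrow> t < r \<longrightarrow>
    (\<lambda>k. barnes_coeff d w k * of_real t ^ k) sums barnes_kernel d w t"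
proof -
  define r where "r = Min ((\<lambda>i. 2 * pi / norm (w i)) ` {1..d})"
  have "r > 0"
    unfolding r_def using d w by (subst Min_gr_iff) auto
  moreover have "(\<lambda>k. barnes_coeff d w k * of_real t ^ k) sums barnes_kernel d w t"
    if t: "0 < t" "t < r" for t
  proof -
    have "(\<lambda>k. bernoulli_num_ho d k w * (- of_real t) ^ k / fact k) sums bernoulli_gf d w (- of_real t)"
    proof (rule bernoulli_num_ho_sums[OF d w])
      fix i assume i: "i \<in> {1..d}"
      hence "t < 2 * pi / norm (w i)" using t d by (auto simp: r_def)
      thus "norm (- complex_of_real t) * norm (w i) < 2 * pi"
        using w[OF i] t by (simp add: field_simps)
    qed
    from sums_divide[OF this, of "\<Prod>i=1..d. w i"]
    show "(\<lambda>k. barnes_coeff d w k * of_real t ^ k) sums barnes_kernel d w t"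
      using t by (subst barnes_kernel_eq[OF w])
         (simp_all add: barnes_coeff_def power_minus[of "of_real t"] mult_ac)
  qed
  ultimately show ?thesis by blast
qed

text \<open>Away from 0 each denominator is bounded below by its value for \<open>Re (w i)\<close>
  at \<delta>, which leaves growth of order \<open>t ^ d\<close>.\<close>

lemma norm_barnes_kernel_le:
  assumes "\<And>i. i \<in> {1..d} \<Longrightarrow> Re (w i) > 0" "0 < \<delta>" "\<delta> \<le> t"
  shows "norm (barnes_kernel d w t) \<le> t ^ d * (\<Prod>i=1..d. 1 / (1 - exp (- Re (w i) * \<delta>)))"
proof -
  have "norm (barnes_kernel d w t) \<le> (\<Prod>i=1..d. t * (1 / (1 - exp (- Re (w i) * \<delta>))))"
    unfolding barnes_kernel_def prod_norm [symmetric]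
  proof (rule prod_mono)
    fix i assume i: "i \<in> {1..d}"
    have "1 - exp (- Re (w i) * \<delta>) \<le> 1 - exp (- Re (w i) * t)"
      using assms(1)[OF i] assms(2,3) by (simp add: mult_left_mono)
    also have "\<dots> = norm (1 :: complex) - norm (exp (- w i * of_real t))" by simp
    also have "\<dots> \<le> norm (1 - exp (- w i * of_real t))" by (rule norm_triangle_ineq2)
    finally have "1 - exp (- Re (w i) * \<delta>) \<le> norm (1 - exp (- w i * of_real t))" .
    moreover have "1 - exp (- Re (w i) * \<delta>) > 0" using assms(1)[OF i] assms(2) by simp
    ultimately show "0 \<le> norm (of_real t / (1 - exp (- w i * of_real t))) \<and>
        norm (of_real t / (1 - exp (- w i * of_real t))) \<le> t * (1 / (1 - exp (- Re (w i) * \<delta>)))"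
      using assms(2,3) by (auto simp: norm_divide intro!: divide_left_mono mult_pos_pos)
  qed
  thus ?thesis by (simp only: prod.distrib prod_constant card_atLeastAtMost) simp
qed

text \<open>One bound for all \<open>t > 0\<close>. Near 0 the tail is a power series remainder of
  order \<open>t ^ N\<close>; far out a crude polynomial bound suffices, because it will be
  multiplied by an exponential.\<close>

lemma norm_barnes_tail_le:
  assumes d: "d \<ge> 1" and w: "\<And>i. i \<in> {1..d} \<Longrightarrow> Re (w i) > 0"
  obtains C where "C \<ge> 0" "\<And>t. t > 0 \<Longrightarrow> norm (barnes_tail d N w t) \<le> C * (t ^ N + t ^ (N + d))"
proof -
  have w0: "w i \<noteq> 0" if "i \<in> {1..d}" for i using w[OF that] by auto
  obtain r where r: "r > 0" and sums: "\<And>t. 0 < t \<Longrightarrow> t < r \<Longrightarrow>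
      (\<lambda>k. barnes_coeff d w k * of_real t ^ k) sums barnes_kernel d w t"
    using barnes_kernel_sums[of d w, OF d w0] by blast
  let ?b = "barnes_coeff d w"
  define \<delta> where "\<delta> = r / 2"
  have \<delta>: "\<delta> > 0" using r by (simp add: \<delta>_def)
  \<comment> \<open>Absolute convergence at \<delta> follows from convergence at
    \<open>3 / 4 * r\<close>, a point farther out but still inside the disc.\<close>
  have "summable (\<lambda>k. norm (?b k * complex_of_real \<delta> ^ k))"
  proof (rule powser_insidea)
    show "summable (\<lambda>k. ?b k * complex_of_real (3 / 4 * r) ^ k)"
      using sums[of "3 / 4 * r"] r by (simp add: sums_iff)
    show "norm (complex_of_real \<delta>) < norm (complex_of_real (3 / 4 * r))"
      using r by (simp add: \<delta>_def)
  qed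
  hence "summable (\<lambda>k. norm (?b (k + N)) * \<delta> ^ (k + N))"
    using \<delta> summable_iff_shift[of "\<lambda>k. norm (?b k) * \<delta> ^ k" N] by (simp add: norm_mult norm_power)
  hence "summable (\<lambda>k. norm (?b (k + N)) * \<delta> ^ (k + N) / \<delta> ^ N)"
    by (rule summable_divide)
  hence sm: "summable (\<lambda>k. norm (?b (k + N)) * \<delta> ^ k)"
    using \<delta> by (simp add: power_add)
  \<comment> \<open>\<open>C1\<close> bounds the remainder series divided by \<open>t ^ N\<close>
    for \<open>t \<le> \<delta>\<close>. \<open>C2\<close> and \<open>C3\<close> bound the kernel
    and the Taylor polynomial for \<open>t \<ge> \<delta>\<close>; the powers of \<delta> in their
    denominators pay for raising the exponents to \<open>N + d\<close> and \<open>N\<close>.\<close>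
  define C1 where "C1 = (\<Sum>k. norm (?b (k + N)) * \<delta> ^ k)"
  define C2 where "C2 = (\<Prod>i=1..d. 1 / (1 - exp (- Re (w i) * \<delta>))) / \<delta> ^ N"
  define C3 where "C3 = (\<Sum>k<N. norm (?b k) / \<delta> ^ (N - k))"
  have C1: "C1 \<ge> 0" unfolding C1_def using \<delta> by (intro suminf_nonneg sm) auto
  have C2: "C2 \<ge> 0" unfolding C2_def using \<delta> w
    by (intro divide_nonneg_pos prod_nonneg) (auto simp: less_imp_le)
  have C3: "C3 \<ge> 0" unfolding C3_def using \<delta> by (intro sum_nonneg) auto
  have small: "norm (barnes_tail d N w t) \<le> C1 * t ^ N" if t: "0 < t" "t \<le> \<delta>" for t
  proof -
    have "(\<lambda>k. ?b (k + N) * complex_of_real t ^ (k + N)) sums barnes_tail d N w t"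
      unfolding barnes_tail_def using sums[of t] t r
      by (subst sums_iff_shift) (auto simp: \<delta>_def)
    moreover have "summable (\<lambda>k. t ^ N * (norm (?b (k + N)) * \<delta> ^ k))"
      by (rule summable_mult[OF sm])
    moreover have "norm (?b (k + N) * complex_of_real t ^ (k + N)) \<le> t ^ N * (norm (?b (k + N)) * \<delta> ^ k)" for k
    proof -
      have "norm (?b (k + N)) * t ^ k \<le> norm (?b (k + N)) * \<delta> ^ k"
        using t by (intro mult_left_mono power_mono) auto
      hence "t ^ N * (norm (?b (k + N)) * t ^ k) \<le> t ^ N * (norm (?b (k + N)) * \<delta> ^ k)"
        by (rule mult_left_mono) (use t in auto)
      moreover have "norm (?b (k + N) * complex_of_real t ^ (k + N)) = t ^ N * (norm (?b (k + N)) * t ^ k)"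
        using t by (simp add: norm_mult norm_power power_add)
      ultimately show ?thesis by (simp only:)
    qed
    ultimately have "norm (barnes_tail d N w t) \<le> (\<Sum>k. t ^ N * (norm (?b (k + N)) * \<delta> ^ k))"
      using norm_suminf_le[of "\<lambda>k. ?b (k + N) * complex_of_real t ^ (k + N)"] by (simp add: sums_iff)
    also have "\<dots> = C1 * t ^ N" unfolding C1_def by (subst suminf_mult[OF sm]) simp
    finally show ?thesis .
  qed
  have large: "norm (barnes_tail d N w t) \<le> C2 * t ^ (N + d) + C3 * t ^ N" if t: "\<delta> \<le> t" for t
  proof -
    have t0: "t > 0" using t \<delta> by linarith
    have "norm (barnes_kernel d w t) \<le> t ^ d * (C2 * \<delta> ^ N)"
      using norm_barnes_kernel_le[OF w \<delta> t] \<delta> by (simp add: C2_def)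
    also have "\<dots> \<le> t ^ d * (C2 * t ^ N)"
      using C2 \<delta> t by (intro mult_left_mono power_mono) auto
    finally have 1: "norm (barnes_kernel d w t) \<le> C2 * t ^ (N + d)" by (simp add: power_add mult_ac)
    have "norm (\<Sum>k<N. ?b k * complex_of_real t ^ k) \<le> (\<Sum>k<N. norm (?b k) / \<delta> ^ (N - k) * t ^ N)"
    proof (rule sum_norm_le)
      fix k assume "k \<in> {..<N}"
      hence "t ^ N = t ^ k * t ^ (N - k)" by (simp flip: power_add)
      moreover have "\<delta> ^ (N - k) \<le> t ^ (N - k)" using \<delta> t by (intro power_mono) auto
      ultimately have "t ^ k \<le> t ^ N / \<delta> ^ (N - k)" using \<delta> t0 by (simp add: field_simps)
      hence "norm (?b k) * t ^ k \<le> norm (?b k) * (t ^ N / \<delta> ^ (N - k))" by (intro mult_left_mono) auto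
      thus "norm (?b k * complex_of_real t ^ k) \<le> norm (?b k) / \<delta> ^ (N - k) * t ^ N"
        using t0 by (simp add: norm_mult norm_power)
    qed
    also have "\<dots> = C3 * t ^ N" by (simp add: C3_def sum_distrib_right)
    finally have 2: "norm (\<Sum>k<N. ?b k * complex_of_real t ^ k) \<le> C3 * t ^ N" .
    show ?thesis unfolding barnes_tail_def
      using norm_triangle_ineq4[of "barnes_kernel d w t" "\<Sum>k<N. ?b k * complex_of_real t ^ k"] 1 2 by linarith
  qed
  show ?thesis
  proof
    show "C1 + C2 + C3 \<ge> 0" using C1 C2 C3 by simp
    fix t :: real assume t: "t > 0"
    have "0 \<le> C1 * t ^ N" "0 \<le> C2 * t ^ N" "0 \<le> C3 * t ^ N"
         "0 \<le> C1 * t ^ (N + d)" "0 \<le> C2 * t ^ (N + d)" "0 \<le> C3 * t ^ (N + d)"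
      using C1 C2 C3 t by auto
    moreover have "norm (barnes_tail d N w t) \<le> C1 * t ^ N \<or>
        norm (barnes_tail d N w t) \<le> C2 * t ^ (N + d) + C3 * t ^ N"
      using small[of t] large[of t] t by (cases "t \<le> \<delta>") auto
    moreover have "(C1 + C2 + C3) * (t ^ N + t ^ (N + d)) = C1 * t ^ N + C2 * t ^ N + C3 * t ^ N
        + C1 * t ^ (N + d) + C2 * t ^ (N + d) + C3 * t ^ (N + d)"
      by (simp add: ring_distribs)
    ultimately show "norm (barnes_tail d N w t) \<le> (C1 + C2 + C3) * (t ^ N + t ^ (N + d))"
      by linarith
  qed
qed

section \<open>The truncated Mellin transform\<close>

text \<open>The exponent is lowered by \<open>d\<close> because \<open>barnes_kernel\<close> carries
  the factor \<open>t ^ d\<close>.\<close>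

definition barnes_integrand :: "nat \<Rightarrow> nat \<Rightarrow> complex \<Rightarrow> (nat \<Rightarrow> complex) \<Rightarrow> complex \<Rightarrow> real \<Rightarrow> complex" where
  "barnes_integrand d N a w s t =
     of_real t powr (s - of_nat d - 1) * exp (- a * of_real t) * barnes_tail d N w t"

lemma continuous_on_barnes_tail:
  assumes "\<And>i. i \<in> {1..d} \<Longrightarrow> Re (w i) > 0"
  shows "continuous_on {0<..} (barnes_tail d N w)"
  unfolding barnes_tail_def[abs_def] barnes_kernel_def
  by (intro continuous_intros) (use one_minus_exp_nonzero[OF assms] in auto)

lemma continuous_on_barnes_integrand:
  assumes "\<And>i. i \<in> {1..d} \<Longrightarrow> Re (w i) > 0"
  shows "continuous_on {0<..} (barnes_integrand d N a w s)"
  unfolding barnes_integrand_def[abs_def]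
  by (intro continuous_on_mult continuous_on_powr_times_exp continuous_on_barnes_tail assms)

text \<open>The constant is independent of \<open>s\<close>, since \<open>s\<close> enters the norm
  only through a power of \<open>t\<close> with exponent governed by \<open>Re s\<close>. This
  uniformity provides the majorants for holomorphy.\<close>

lemma norm_barnes_integrand_le:
  assumes "d \<ge> 1" and "\<And>i. i \<in> {1..d} \<Longrightarrow> Re (w i) > 0"
  shows "\<exists>C\<ge>0. \<forall>s t. t > 0 \<longrightarrow> norm (barnes_integrand d N a w s t) \<le>
    C * (t powr (Re s - d - 1 + N) + t powr (Re s - 1 + N)) * exp (- Re a * t)"
proof -
  obtain C where C: "C \<ge> 0" "\<And>t. t > 0 \<Longrightarrow> norm (barnes_tail d N w t) \<le> C * (t ^ N + t ^ (N + d))"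
    using norm_barnes_tail_le[of d w N, OF assms] by blast
  have "norm (barnes_integrand d N a w s t) \<le>
    C * (t powr (Re s - d - 1 + N) + t powr (Re s - 1 + N)) * exp (- Re a * t)" if t: "t > 0" for s t
  proof -
    have "norm (barnes_integrand d N a w s t) =
        t powr (Re s - d - 1) * exp (- Re a * t) * norm (barnes_tail d N w t)"
      unfolding barnes_integrand_def norm_mult[of _ "barnes_tail d N w t"]
      by (subst norm_powr_times_exp[OF t]) simp
    also have "\<dots> \<le> t powr (Re s - d - 1) * exp (- Re a * t) * (C * (t ^ N + t ^ (N + d)))"
      using C(2)[OF t] by (intro mult_left_mono) auto
    also have "\<dots> = C * (t powr (Re s - d - 1) * t powr N + t powr (Re s - d - 1) * t powr (N + d)) * exp (- Re a * t)"
      using t by (subst (1 2) powr_realpow[symmetric]) (simp_all add: algebra_simps)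
    also have "\<dots> = C * (t powr (Re s - d - 1 + N) + t powr (Re s - 1 + N)) * exp (- Re a * t)"
      by (simp flip: powr_add add: algebra_simps)
    finally show ?thesis .
  qed
  with C(1) show ?thesis by blast
qed

lemma set_integrable_barnes_integrand:
  assumes "d \<ge> 1" "Re a > 0" and w: "\<And>i. i \<in> {1..d} \<Longrightarrow> Re (w i) > 0"
    and s: "Re s > real d - real N"
  shows "set_integrable lborel {0<..} (barnes_integrand d N a w s)"
proof -
  obtain C where C: "C \<ge> 0" "\<And>s t. t > 0 \<Longrightarrow> norm (barnes_integrand d N a w s t) \<le>
    C * (t powr (Re s - d - 1 + N) + t powr (Re s - 1 + N)) * exp (- Re a * t)"
    using norm_barnes_integrand_le[of d w, OF \<open>d \<ge> 1\<close> w] by blast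
  show ?thesis
  proof (rule set_integrable_bound)
    have "set_integrable lborel {0<..} (\<lambda>t. C * (t powr (Re s - d - 1 + N) * exp (- Re a * t))
            + C * (t powr (Re s - 1 + N) * exp (- Re a * t)))"
      by (intro set_integral_add set_integrable_mult_right set_integrable_powr_exp) (use assms in auto)
    thus "set_integrable lborel {0<..}
        (\<lambda>t. C * (t powr (Re s - d - 1 + N) + t powr (Re s - 1 + N)) * exp (- Re a * t))"
      by (simp add: algebra_simps)
    show "set_borel_measurable lborel {0<..} (barnes_integrand d N a w s)"
      using borel_measurable_continuous_on_indicator[OF _ continuous_on_barnes_integrand[of d w, OF w]]
      by (simp add: set_borel_measurable_def)
    show "AE t in lborel. t \<in> {0<..} \<longrightarrow> norm (barnes_integrand d N a w s t) \<le>
        norm (C * (t powr (Re s - d - 1 + N) + t powr (Re s - 1 + N)) * exp (- Re a * t))"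
    proof (intro AE_I2 impI)
      fix t :: real assume "t \<in> {0<..}"
      thus "norm (barnes_integrand d N a w s t) \<le>
          norm (C * (t powr (Re s - d - 1 + N) + t powr (Re s - 1 + N)) * exp (- Re a * t))"
        unfolding real_norm_def using C(2)[of t s] by (intro order.trans[OF _ abs_ge_self]) simp
    qed
  qed
qed

text \<open>Bounds \<open>t powr y\<close> uniformly over a range of exponents: the upper endpoint
  dominates for \<open>t \<ge> 1\<close>, the lower one for \<open>t < 1\<close>.\<close>

lemma powr_le_sum_powr:
  fixes t x y z :: real
  assumes "x \<le> y" "y \<le> z" "t > 0"
  shows "t powr y \<le> t powr x + t powr z"
proof (cases "t \<ge> 1")
  case True
  thus ?thesis using powr_mono[of y z t] assms by (intro add_increasing) auto
next
  case False
  thus ?thesis using powr_mono'[of x y t] assms by (intro add_increasing2) auto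
qed

lemma powr_add_of_nat:
  fixes t :: real and z :: complex
  assumes "t > 0"
  shows "of_real t powr (z + of_nat n) = of_real t powr z * of_real t ^ n"
  using assms by (simp add: powr_add powr_nat')

lemma holomorphic_barnes_integral:
  assumes "d \<ge> 1" "Re a > 0" and w: "\<And>i. i \<in> {1..d} \<Longrightarrow> Re (w i) > 0"
  shows "(\<lambda>s. LINT t:{0<..}|lborel. barnes_integrand d N a w s t) holomorphic_on
           {s. Re s > real d - real N}"
proof (rule holomorphic_on_set_integral_Ioi[where
      f' = "\<lambda>s t. of_real (ln t) * barnes_integrand d N a w s t"])
  fix s :: complex and t :: real assume "t > 0"
  have "((\<lambda>s. of_real t powr (s - of_nat d - 1)) has_field_derivative
          Ln (of_real t) * of_real t powr (s - of_nat d - 1) * 1) (at s)"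
    by (rule DERIV_chain2[OF has_field_derivative_powr_right])
       (use \<open>t > 0\<close> in \<open>auto intro!: derivative_eq_intros\<close>)
  hence "((\<lambda>s. of_real t powr (s - of_nat d - 1) * (exp (- a * of_real t) * barnes_tail d N w t))
      has_field_derivative Ln (of_real t) * of_real t powr (s - of_nat d - 1) * 1 *
        (exp (- a * of_real t) * barnes_tail d N w t)) (at s)"
    by (rule DERIV_cmult_right)
  thus "((\<lambda>s. barnes_integrand d N a w s t) has_field_derivative
          of_real (ln t) * barnes_integrand d N a w s t) (at s)"
    using \<open>t > 0\<close> by (simp add: barnes_integrand_def Ln_of_real mult.assoc)
next
  show "continuous_on ({s. Re s > real d - real N} \<times> {0<..})
          (\<lambda>(s, t). of_real (ln t) * barnes_integrand d N a w s t)"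
    unfolding barnes_integrand_def case_prod_unfold
    by (intro continuous_intros continuous_on_compose2[OF continuous_on_barnes_tail[of d w, OF w]])
       (auto simp: complex_nonpos_Reals_iff)
next
  fix s assume s: "s \<in> {s. Re s > real d - real N}"
  obtain C where C: "C \<ge> 0" "\<And>s t. t > 0 \<Longrightarrow> norm (barnes_integrand d N a w s t) \<le>
    C * (t powr (Re s - d - 1 + N) + t powr (Re s - 1 + N)) * exp (- Re a * t)"
    using norm_barnes_integrand_le[of d w, OF \<open>d \<ge> 1\<close> w] by blast
  \<comment> \<open>Half the distance to the boundary line, so that the lower exponent bound
    \<open>x\<close> still lies in the half-plane of convergence.\<close>
  define \<rho> where "\<rho> = (Re s - (real d - real N)) / 2"
  define x where "x = Re s - \<rho>"
  define y where "y = Re s + \<rho>"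
  have \<rho>: "\<rho> > 0" and x: "x > real d - real N" and y: "y > real d - real N"
    using s by (auto simp: \<rho>_def x_def y_def field_simps)
  have Re_bounds: "x \<le> Re z" "Re z \<le> y" if "z \<in> ball s \<rho>" for z
    using abs_Re_le_cmod[of "s - z"] that by (auto simp: dist_norm x_def y_def)
  \<comment> \<open>Each of the two powers in the bound is replaced by its values at both ends of
    the range of \<open>Re z\<close>.\<close>
  define g where "g t = C * (t powr (x - d - 1 + N) * exp (- Re a * t)) + C * (t powr (y - d - 1 + N) * exp (- Re a * t))
      + C * (t powr (x - 1 + N) * exp (- Re a * t)) + C * (t powr (y - 1 + N) * exp (- Re a * t))" for t
  have "set_integrable lborel {0<..} g"
    unfolding g_def by (intro set_integral_add set_integrable_mult_right set_integrable_powr_exp)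
      (use assms x y in auto)
  moreover have "norm (barnes_integrand d N a w z t) \<le> g t" if "z \<in> ball s \<rho>" "t > 0" for z t
  proof -
    have "norm (barnes_integrand d N a w z t) \<le>
        C * (t powr (Re z - d - 1 + N) + t powr (Re z - 1 + N)) * exp (- Re a * t)"
      using C(2) that by blast
    also have "\<dots> \<le> C * ((t powr (x - d - 1 + N) + t powr (y - d - 1 + N)) +
        (t powr (x - 1 + N) + t powr (y - 1 + N))) * exp (- Re a * t)"
      using Re_bounds[OF that(1)] C(1) that(2)
      by (intro mult_right_mono mult_left_mono add_mono powr_le_sum_powr) auto
    also have "\<dots> = g t" by (simp add: g_def algebra_simps)
    finally show ?thesis .
  qed
  moreover have "ball s \<rho> \<subseteq> {s. Re s > real d - real N}"
    using Re_bounds x by fastforce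
  ultimately show "\<exists>r>0. \<exists>g. ball s r \<subseteq> {s. Re s > real d - real N} \<and> set_integrable lborel {0<..} g \<and>
      (\<forall>z\<in>ball s r. \<forall>t>0. norm (barnes_integrand d N a w z t) \<le> g t)"
    using \<rho> by blast
qed (rule continuous_on_barnes_integrand[of d w, OF w])

text \<open>The tails of index \<open>N\<close> and \<open>Suc N\<close> differ by one Taylor term,
  whose integral is a Gamma integral with rate \<open>a\<close>.\<close>

lemma barnes_integral_Suc:
  assumes "d \<ge> 1" "Re a > 0" and w: "\<And>i. i \<in> {1..d} \<Longrightarrow> Re (w i) > 0"
    and s: "Re s > real d - real N"
  shows "(LINT t:{0<..}|lborel. barnes_integrand d N a w s t) =
         (LINT t:{0<..}|lborel. barnes_integrand d (Suc N) a w s t) +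
         barnes_coeff d w N * (Gamma (s - of_nat d + of_nat N) * a powr (- (s - of_nat d + of_nat N)))"
proof -
  let ?z = "s - of_nat d + of_nat N"
  let ?h = "\<lambda>t::real. of_real t powr (?z - 1) * exp (- a * of_real t)"
  have z: "Re ?z > 0" using s by simp
  have eq: "barnes_integrand d N a w s t = barnes_integrand d (Suc N) a w s t + barnes_coeff d w N * ?h t"
    if t: "t > 0" for t
  proof -
    have "complex_of_real t powr (?z - 1) = of_real t powr (s - of_nat d - 1 + of_nat N)"
      by (simp add: algebra_simps)
    also have "\<dots> = complex_of_real t powr (s - of_nat d - 1) * of_real t ^ N"
      by (rule powr_add_of_nat[OF t])
    finally show ?thesis
      by (simp add: barnes_integrand_def barnes_tail_def algebra_simps)
  qed
  have "(LINT t:{0<..}|lborel. barnes_integrand d N a w s t) =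
        (LINT t:{0<..}|lborel. barnes_integrand d (Suc N) a w s t + barnes_coeff d w N * ?h t)"
    by (intro set_lebesgue_integral_cong) (use eq in auto)
  also have "\<dots> = (LINT t:{0<..}|lborel. barnes_integrand d (Suc N) a w s t) +
      (LINT t:{0<..}|lborel. barnes_coeff d w N * ?h t)"
    by (intro set_integral_add set_integrable_barnes_integrand set_integrable_mult_right
          set_integrable_complex_powr_exp) (use assms z in auto)
  also have "(LINT t:{0<..}|lborel. barnes_coeff d w N * ?h t) =
      barnes_coeff d w N * (LINT t:{0<..}|lborel. ?h t)"
    by (rule set_integral_mult_right)
  also have "(LINT t:{0<..}|lborel. ?h t) = Gamma ?z * a powr (- ?z)"
    by (rule Gamma_integral_complex_rate[OF z assms(2)])
  finally show ?thesis .
qed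

text \<open>The sum in \<open>barnes_I\<close> runs up to \<open>M\<close> inclusive, hence the tail
  index \<open>Suc M\<close>. Writing \<open>rGamma\<close> for the reciprocal makes the prefactor
  visibly entire.\<close>

lemma barnes_I_eq:
  assumes w: "\<And>i. i \<in> {1..d} \<Longrightarrow> Re (w i) > 0"
  shows "barnes_I d M s a w = rGamma s * (LINT t:{0<..}|lborel. barnes_integrand d (Suc M) a w s t)"
proof -
  have "exp (- a * of_real t) *
      (of_real t powr (s - 1) / (\<Prod>i=1..d. 1 - exp (- w i * of_real t))
       - of_real t powr (s - of_nat d - 1) / (\<Prod>i=1..d. w i) *
         (\<Sum>k=0..M. (-1) ^ k * bernoulli_num_ho d k w * of_real t ^ k / fact k)) =
      barnes_integrand d (Suc M) a w s t" if t: "t > 0" for t :: real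
  proof -
    have "complex_of_real t powr (s - 1) = of_real t powr (s - of_nat d - 1 + of_nat d)"
      by (simp add: algebra_simps)
    also have "\<dots> = complex_of_real t powr (s - of_nat d - 1) * of_real t ^ d"
      by (rule powr_add_of_nat[OF t])
    finally have 1: "of_real t powr (s - 1) / (\<Prod>i=1..d. 1 - exp (- w i * of_real t)) =
        complex_of_real t powr (s - of_nat d - 1) * barnes_kernel d w t"
      by (simp add: barnes_kernel_def prod_dividef)
    have 2: "1 / (\<Prod>i=1..d. w i) * (\<Sum>k=0..M. (-1) ^ k * bernoulli_num_ho d k w * of_real t ^ k / fact k) =
        (\<Sum>k<Suc M. barnes_coeff d w k * of_real t ^ k)"
      unfolding sum_distrib_left lessThan_Suc_atMost atMost_atLeast0
      by (intro sum.cong refl) (simp add: barnes_coeff_def field_simps)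
    show ?thesis
      unfolding barnes_integrand_def barnes_tail_def 1 2[symmetric] by (simp add: algebra_simps)
  qed
  hence "barnes_I d M s a w = 1 / Gamma s * (LINT t:{0<..}|lborel. barnes_integrand d (Suc M) a w s t)"
    unfolding barnes_I_def by (intro arg_cong2[of _ _ _ _ "(*)"] refl set_lebesgue_integral_cong) auto
  thus ?thesis by (simp add: rGamma_inverse_Gamma field_simps)
qed

section \<open>The Barnes series as a Mellin transform\<close>

text \<open>The type is general because the formula is applied both to complex ratios and to their
  norms.\<close>

lemma infsum_prod_geometric:
  fixes x :: "nat \<Rightarrow> 'a :: {real_normed_field, banach}"
  assumes "\<And>i. i \<in> {1..d} \<Longrightarrow> norm (x i) < 1"
  shows "(\<Sum>\<^sub>\<infinity>n \<in> {1..d} \<rightarrow>\<^sub>E (UNIV :: nat set). \<Prod>i=1..d. x i ^ n i) = (\<Prod>i=1..d. 1 / (1 - x i))"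
proof -
  have sm: "(\<lambda>k. norm (x i ^ k)) summable_on UNIV" if "i \<in> {1..d}" for i
    using norm_summable_imp_summable_on[of "\<lambda>k. norm (x i ^ k)"] assms[OF that]
    by (simp add: norm_power summable_geometric)
  have "(\<Sum>\<^sub>\<infinity>n \<in> {1..d} \<rightarrow>\<^sub>E (UNIV :: nat set). \<Prod>i=1..d. x i ^ n i) = (\<Prod>i=1..d. \<Sum>\<^sub>\<infinity>k. x i ^ k)"
    by (rule infsum_prod_PiE_abs) (use sm in auto)
  also have "\<dots> = (\<Prod>i=1..d. 1 / (1 - x i))"
  proof (intro prod.cong refl)
    fix i assume i: "i \<in> {1..d}"
    have "((\<lambda>k. x i ^ k) has_sum (1 / (1 - x i))) UNIV"
      by (rule norm_summable_imp_has_sum)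
         (use assms[OF i] in \<open>auto simp: norm_power summable_geometric intro: geometric_sums\<close>)
    thus "(\<Sum>\<^sub>\<infinity>k. x i ^ k) = 1 / (1 - x i)" by (rule infsumI)
  qed
  finally show ?thesis .
qed

lemma has_sum_prod_geometric:
  fixes x :: "nat \<Rightarrow> complex"
  assumes "\<And>i. i \<in> {1..d} \<Longrightarrow> norm (x i) < 1"
  shows "(\<lambda>n. norm (\<Prod>i=1..d. x i ^ n i)) summable_on ({1..d} \<rightarrow>\<^sub>E (UNIV :: nat set))"
    and "((\<lambda>n. \<Prod>i=1..d. x i ^ n i) has_sum (\<Prod>i=1..d. 1 / (1 - x i))) ({1..d} \<rightarrow>\<^sub>E UNIV)"
proof -
  \<comment> \<open>A non-summable family would have infinite sum 0 by convention.\<close>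
  have "(\<Sum>\<^sub>\<infinity>n \<in> {1..d} \<rightarrow>\<^sub>E (UNIV :: nat set). \<Prod>i=1..d. norm (x i) ^ n i) = (\<Prod>i=1..d. 1 / (1 - norm (x i)))"
    by (rule infsum_prod_geometric) (use assms in auto)
  moreover have "(\<Prod>i=1..d. 1 / (1 - norm (x i))) > 0"
    using assms by (intro prod_pos) auto
  ultimately have "(\<Sum>\<^sub>\<infinity>n \<in> {1..d} \<rightarrow>\<^sub>E (UNIV :: nat set). \<Prod>i=1..d. norm (x i) ^ n i) \<noteq> 0"
    by linarith
  hence "(\<lambda>n. \<Prod>i=1..d. norm (x i) ^ n i) summable_on ({1..d} \<rightarrow>\<^sub>E UNIV)"
    using infsum_not_exists by blast
  thus abs: "(\<lambda>n. norm (\<Prod>i=1..d. x i ^ n i)) summable_on ({1..d} \<rightarrow>\<^sub>E (UNIV :: nat set))"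
    by (simp add: prod_norm[symmetric] norm_power)
  show "((\<lambda>n. \<Prod>i=1..d. x i ^ n i) has_sum (\<Prod>i=1..d. 1 / (1 - x i))) ({1..d} \<rightarrow>\<^sub>E UNIV)"
    using has_sum_infsum[OF abs_summable_summable[OF abs]] infsum_prod_geometric[of d x, OF assms] by simp
qed

text \<open>For fixed \<open>t\<close> each factor \<open>1 / (1 - exp (- w i * t))\<close> is a
  geometric series, and multiplying them out gives the sum over the lattice. With index 0 no Taylor
  term is subtracted.\<close>

lemma barnes_lattice_sum:
  fixes a s :: complex and t :: real
  assumes w: "\<And>i. i \<in> {1..d} \<Longrightarrow> Re (w i) > 0" and t: "t > 0"
  defines "f \<equiv> \<lambda>n. of_real t powr (s - 1) * exp (- (a + (\<Sum>i=1..d. of_nat (n i) * w i)) * of_real t)"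
  shows "(\<lambda>n. norm (f n)) summable_on ({1..d} \<rightarrow>\<^sub>E (UNIV :: nat set))"
    and "(f has_sum barnes_integrand d 0 a w s t) ({1..d} \<rightarrow>\<^sub>E UNIV)"
proof -
  let ?x = "\<lambda>i. exp (- w i * of_real t)"
  have x: "norm (?x i) < 1" if "i \<in> {1..d}" for i
    by (rule norm_exp_less_1[OF w[OF that] t])
  define c where "c = of_real t powr (s - 1) * exp (- a * of_real t)"
  have f: "f n = c * (\<Prod>i=1..d. ?x i ^ n i)" for n
  proof -
    have "- (a + (\<Sum>i=1..d. of_nat (n i) * w i)) * of_real t =
        - a * of_real t + (\<Sum>i=1..d. of_nat (n i) * (- w i * of_real t))"
      by (simp add: ring_distribs sum_distrib_left sum_distrib_right sum_negf mult_ac)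
    thus ?thesis
      by (simp only: f_def c_def exp_add exp_sum finite_atLeastAtMost exp_of_nat_mult mult.assoc)
  qed
  show "(\<lambda>n. norm (f n)) summable_on ({1..d} \<rightarrow>\<^sub>E (UNIV :: nat set))"
    unfolding f norm_mult by (intro summable_on_cmult_right has_sum_prod_geometric x)
  have "complex_of_real t powr (s - 1) = of_real t powr (s - of_nat d - 1 + of_nat d)"
    by (simp add: algebra_simps)
  also have "\<dots> = complex_of_real t powr (s - of_nat d - 1) * of_real t ^ d"
    by (rule powr_add_of_nat[OF t])
  finally have "barnes_integrand d 0 a w s t = c * (\<Prod>i=1..d. 1 / (1 - ?x i))"
    by (simp add: barnes_integrand_def barnes_tail_def barnes_kernel_def c_def prod_dividef)
  thus "(f has_sum barnes_integrand d 0 a w s t) ({1..d} \<rightarrow>\<^sub>E UNIV)"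
    by (simp only: ext[of f, OF f]) (intro has_sum_cmult_right has_sum_prod_geometric(2) x)
qed

text \<open>Needed to enumerate the lattice bijectively by the natural numbers; the constant vectors
  are already infinitely many.\<close>

lemma infinite_PiE_nat:
  fixes d :: nat
  assumes "d \<ge> 1"
  shows "infinite ({1..d} \<rightarrow>\<^sub>E (UNIV :: nat set))"
proof
  assume "finite ({1..d} \<rightarrow>\<^sub>E (UNIV :: nat set))"
  hence "finite (range (\<lambda>m::nat. \<lambda>i\<in>{1..d}. m))" by (rule finite_subset[rotated]) auto
  moreover have "inj (\<lambda>m::nat. \<lambda>i\<in>{1..d}. m)"
  proof
    fix m n :: nat assume "(\<lambda>i\<in>{1..d}. m) = (\<lambda>i\<in>{1..d}. n)"
    from fun_cong[OF this, of 1] assms show "m = n" by simp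
  qed
  ultimately show False using finite_imageD by blast
qed

text \<open>Each summand times \<open>Gamma s\<close> is a Gamma integral with rate
  \<open>l n\<close>. Sum and integral may be exchanged because the sum of the norms is an integrand
  of the same kind, integrable for \<open>Re s > d\<close>.\<close>

lemma barnes_series_eq_integral:
  assumes d: "d \<ge> 1" and a: "Re a > 0" and w: "\<And>i. i \<in> {1..d} \<Longrightarrow> Re (w i) > 0"
    and s: "Re s > real d"
  shows "barnes_series d s a w = rGamma s * (LINT t:{0<..}|lborel. barnes_integrand d 0 a w s t)"
proof -
  define A where "A = {1..d} \<rightarrow>\<^sub>E (UNIV :: nat set)"
  define l where "l n = a + (\<Sum>i=1..d. of_nat (n i) * w i)" for n :: "nat \<Rightarrow> nat"
  define f where "f n t = of_real t powr (s - 1) * exp (- l n * of_real t)" for n and t :: real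
  define F where "F n t = indicator {0<..} t *\<^sub>R f n t" for n and t :: real
  define G where "G t = indicator {0<..} t *\<^sub>R barnes_integrand d 0 a w s t" for t
  have s0: "Re s > 0" using s by linarith
  have "countable A" unfolding A_def by (intro countable_PiE) auto
  \<comment> \<open>Termwise integration is available for sequences, so the lattice is
    enumerated.\<close>
  then obtain e :: "nat \<Rightarrow> nat \<Rightarrow> nat" where e: "bij_betw e UNIV A"
    using bij_betw_from_nat_into infinite_PiE_nat[OF d] unfolding A_def by blast
  have Re_l: "Re (l n) > 0" for n
    unfolding l_def using a w by (auto intro!: add_pos_nonneg sum_nonneg simp: less_imp_le)
  have int_F: "integrable lborel (F n)" for n
    using set_integrable_complex_powr_exp[OF s0 Re_l[of n]]
    by (simp add: F_def[abs_def] f_def set_integrable_def)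
  have F_eq: "integral\<^sup>L lborel (F n) = Gamma s * l n powr (- s)" for n
    using Gamma_integral_complex_rate[OF s0 Re_l[of n]]
    by (simp add: F_def[abs_def] f_def set_lebesgue_integral_def)
  have abs_f: "(\<lambda>n. norm (f n t)) summable_on A" and sum_f: "((\<lambda>n. f n t) has_sum barnes_integrand d 0 a w s t) A"
    if "t > 0" for t
    using barnes_lattice_sum[of d w t s a, OF w that] unfolding f_def l_def A_def by auto
  have has_sum_F: "((\<lambda>j. F (e j) t) has_sum G t) UNIV" for t
  proof -
    have "((\<lambda>n. F n t) has_sum G t) A"
      using sum_f[of t] by (cases "t > 0") (auto simp: F_def G_def)
    thus ?thesis by (subst has_sum_reindex_bij_betw[OF e])
  qed
  have sm_F: "summable (\<lambda>j. norm (F (e j) t))" for t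
  proof -
    have "(\<lambda>n. norm (F n t)) summable_on A"
      using abs_f[of t] by (cases "t > 0") (auto simp: F_def)
    hence "(\<lambda>j. norm (F (e j) t)) summable_on UNIV"
      by (subst summable_on_reindex_bij_betw[OF e])
    thus ?thesis by (rule summable_on_imp_summable)
  qed
  \<comment> \<open>Replacing all parameters by their real parts turns each summand into its norm.\<close>
  define K where "K t = norm (indicator {0<..} t *\<^sub>R
      barnes_integrand d 0 (of_real (Re a)) (\<lambda>i. of_real (Re (w i))) (of_real (Re s)) t)" for t
  have int_K: "integrable lborel K"
    unfolding K_def using set_integrable_barnes_integrand[of d "of_real (Re a)" "\<lambda>i. of_real (Re (w i))" 0 "of_real (Re s)"]
      d a w s by (intro integrable_norm) (simp add: set_integrable_def)
  have partial: "(\<Sum>j<m. norm (F (e j) t)) \<le> K t" for m t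
  proof (cases "t > 0")
    case True
    let ?g = "\<lambda>n. of_real t powr (of_real (Re s) - 1) *
        exp (- (of_real (Re a) + (\<Sum>i=1..d. of_nat (n i) * of_real (Re (w i)))) * of_real t) :: complex"
    have norm_f: "?g n = of_real (norm (f n t))" for n
    proof -
      have "norm (f n t) = t powr (Re s - 1) * exp (- Re (l n) * t)"
        unfolding f_def by (subst norm_powr_times_exp[OF True]) simp
      moreover have "Re (l n) = Re a + (\<Sum>i=1..d. real (n i) * Re (w i))"
        by (simp add: l_def)
      ultimately show ?thesis
        using True by (simp add: powr_of_real[symmetric] exp_of_real[symmetric])
    qed
    have "(?g has_sum barnes_integrand d 0 (of_real (Re a)) (\<lambda>i. of_real (Re (w i))) (of_real (Re s)) t) A"
      unfolding A_def by (rule barnes_lattice_sum(2)) (use w True in auto)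
    hence "((\<lambda>j. ?g (e j)) has_sum barnes_integrand d 0 (of_real (Re a)) (\<lambda>i. of_real (Re (w i))) (of_real (Re s)) t) UNIV"
      by (subst has_sum_reindex_bij_betw[OF e])
    from has_sum_Re[OF this[unfolded norm_f]]
    have "((\<lambda>j. norm (f (e j) t)) has_sum
        Re (barnes_integrand d 0 (of_real (Re a)) (\<lambda>i. of_real (Re (w i))) (of_real (Re s)) t)) UNIV"
      by simp
    hence "(\<Sum>j<m. norm (f (e j) t)) \<le>
        Re (barnes_integrand d 0 (of_real (Re a)) (\<lambda>i. of_real (Re (w i))) (of_real (Re s)) t)"
      by (rule finite_sum_le_has_sum) auto
    also have "\<dots> \<le> norm (barnes_integrand d 0 (of_real (Re a)) (\<lambda>i. of_real (Re (w i))) (of_real (Re s)) t)"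
      by (rule complex_Re_le_cmod)
    finally show ?thesis using True by (simp add: K_def F_def)
  qed (simp add: K_def F_def)
  \<comment> \<open>All partial sums of the norms lie below \<open>K\<close>, so the sums of their
    integrals are bounded by the integral of \<open>K\<close>.\<close>
  have sm_int: "summable (\<lambda>j. \<integral>t. norm (F (e j) t) \<partial>lborel)"
  proof (rule bounded_imp_summable)
    show "0 \<le> (\<integral>t. norm (F (e j) t) \<partial>lborel)" for j by simp
    show "(\<Sum>j\<le>m. \<integral>t. norm (F (e j) t) \<partial>lborel) \<le> integral\<^sup>L lborel K" for m
    proof -
      have "(\<Sum>j\<le>m. \<integral>t. norm (F (e j) t) \<partial>lborel) = (\<integral>t. (\<Sum>j<Suc m. norm (F (e j) t)) \<partial>lborel)"
        unfolding lessThan_Suc_atMost by (subst Bochner_Integration.integral_sum) (auto intro: int_F)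
      also have "\<dots> \<le> integral\<^sup>L lborel K"
        by (intro integral_mono int_K Bochner_Integration.integrable_sum integrable_norm int_F partial)
      finally show ?thesis .
    qed
  qed
  have "(\<lambda>j. integral\<^sup>L lborel (F (e j))) sums (\<integral>t. (\<Sum>j. F (e j) t) \<partial>lborel)"
    by (rule sums_integral) (use int_F sm_F sm_int in auto)
  also have "(\<lambda>t. \<Sum>j. F (e j) t) = G"
    using has_sum_imp_sums[OF has_sum_F] by (auto simp: sums_iff)
  finally have sums: "(\<lambda>j. Gamma s * l (e j) powr (- s)) sums integral\<^sup>L lborel G"
    by (simp add: F_eq)
  \<comment> \<open>Absolute convergence turns the sum of the sequence into an unordered sum, which
    can be carried back to the lattice along \<open>e\<close>.\<close>
  have "summable (\<lambda>j. norm (Gamma s * l (e j) powr (- s)))"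
    by (rule summable_comparison_test'[OF sm_int, of 0]) (simp flip: F_eq)
  hence "((\<lambda>j. Gamma s * l (e j) powr (- s)) has_sum integral\<^sup>L lborel G) UNIV"
    using sums by (rule norm_summable_imp_has_sum)
  hence "((\<lambda>n. Gamma s * l n powr (- s)) has_sum integral\<^sup>L lborel G) A"
    by (subst (asm) has_sum_reindex_bij_betw[OF e])
  hence "((\<lambda>n. rGamma s * (Gamma s * l n powr (- s))) has_sum rGamma s * integral\<^sup>L lborel G) A"
    by (rule has_sum_cmult_right)
  moreover have "s \<notin> \<int>\<^sub>\<le>\<^sub>0" using s0 by (auto elim!: nonpos_Ints_cases)
  hence "rGamma s * (Gamma s * x) = x" for x
    by (simp add: rGamma_inverse_Gamma Gamma_eq_zero_iff)
  ultimately have "((\<lambda>n. l n powr (- s)) has_sum rGamma s * integral\<^sup>L lborel G) A" by simp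
  thus ?thesis
    unfolding barnes_series_def A_def l_def G_def set_lebesgue_integral_def by (rule infsumI)
qed

section \<open>Meromorphic continuation and finite part\<close>

text \<open>The quotient \<open>Gamma (s - d + k) / Gamma s\<close> times a power of
  \<open>a\<close>, in rational form so that it makes sense beyond the half-plane of the Gamma
  integral. Poles occur only for \<open>k < d\<close>.\<close>

definition barnes_pole_term :: "nat \<Rightarrow> nat \<Rightarrow> complex \<Rightarrow> complex \<Rightarrow> complex" where
  "barnes_pole_term d k a s =
     (if k \<le> d then 1 / (\<Prod>j=1..d-k. s - of_nat j) else pochhammer s (k - d)) *
     a powr (of_nat d - of_nat k - s)"

lemma pochhammer_diff_of_nat:
  "pochhammer (s - of_nat n) n = (\<Prod>j=1..n. s - (of_nat j :: 'a :: comm_ring_1))"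
  unfolding pochhammer_prod
  by (rule prod.reindex_bij_witness[of _ "\<lambda>j. n - j" "\<lambda>i. n - i"]) (auto simp: of_nat_diff)

lemma Gamma_times_rGamma:
  fixes z :: complex
  assumes "Re z > 0"
  shows "Gamma z * rGamma z = 1"
proof -
  have "z \<notin> \<int>\<^sub>\<le>\<^sub>0" using assms by (auto elim!: nonpos_Ints_cases)
  thus ?thesis by (simp add: rGamma_inverse_Gamma Gamma_eq_zero_iff)
qed

text \<open>The functional equation, applied \<open>d - k\<close> or \<open>k - d\<close> times. It
  is used for \<open>rGamma\<close>, where it holds at every point, including the poles of
  \<open>Gamma\<close>.\<close>

lemma Gamma_quotient_eq_barnes_pole_term:
  fixes s :: complex
  assumes "Re s > real d - real k"
  shows "rGamma s * (Gamma (s - of_nat d + of_nat k) * a powr (- (s - of_nat d + of_nat k))) =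
         barnes_pole_term d k a s"
proof -
  let ?z = "s - of_nat d + of_nat k"
  have z: "Re ?z > 0" using assms by simp
  have "rGamma s * Gamma ?z = (if k \<le> d then 1 / (\<Prod>j=1..d-k. s - of_nat j) else pochhammer s (k - d))"
  proof (cases "k \<le> d")
    case True
    hence z_eq: "?z = s - of_nat (d - k)" by (simp add: of_nat_diff)
    have "rGamma ?z = pochhammer ?z (d - k) * rGamma s"
      using pochhammer_rGamma[of ?z "d - k"] by (simp add: z_eq)
    hence "(rGamma s * Gamma ?z) * pochhammer ?z (d - k) = 1"
      using Gamma_times_rGamma[OF z] by (simp add: mult_ac)
    hence "rGamma s * Gamma ?z = 1 / pochhammer ?z (d - k)"
      by (metis mult_zero_right nonzero_eq_divide_eq zero_neq_one)
    thus ?thesis using True by (simp only: z_eq pochhammer_diff_of_nat if_True)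
  next
    case False
    hence z_eq: "?z = s + of_nat (k - d)" by (simp add: of_nat_diff)
    show ?thesis
      using False pochhammer_rGamma[of s "k - d"] Gamma_times_rGamma[OF z] by (simp add: z_eq mult_ac)
  qed
  moreover have "- ?z = of_nat d - of_nat k - s" by simp
  ultimately show ?thesis
    unfolding barnes_pole_term_def mult.assoc[symmetric] by (simp only:)
qed

text \<open>Intended for \<open>Re s > d - N\<close> only, the half-plane where the integral is
  known to converge.\<close>

definition barnes_continuation :: "nat \<Rightarrow> nat \<Rightarrow> complex \<Rightarrow> (nat \<Rightarrow> complex) \<Rightarrow> complex \<Rightarrow> complex" where
  "barnes_continuation d N a w s =
     rGamma s * (LINT t:{0<..}|lborel. barnes_integrand d N a w s t) +
     (\<Sum>k<N. barnes_coeff d w k * barnes_pole_term d k a s)"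

lemma meromorphic_barnes_continuation:
  assumes "d \<ge> 1" "Re a > 0" "\<And>i. i \<in> {1..d} \<Longrightarrow> Re (w i) > 0"
  shows "barnes_continuation d N a w meromorphic_on {s. Re s > real d - real N}"
proof -
  have [simp]: "a \<noteq> 0" using assms(2) by auto
  have pole_term: "barnes_pole_term d k a meromorphic_on A" for k A
  proof -
    have "(\<lambda>s. a powr (of_nat d - of_nat k - s)) holomorphic_on UNIV"
      by (auto intro!: holomorphic_intros)
    hence "(\<lambda>s. a powr (of_nat d - of_nat k - s)) analytic_on UNIV"
      by (simp add: analytic_on_open)
    hence "(\<lambda>s. a powr (of_nat d - of_nat k - s)) meromorphic_on A"
      by (rule analytic_on_imp_meromorphic_on[OF analytic_on_subset[OF _ subset_UNIV]])
    moreover have "(\<lambda>s. if k \<le> d then 1 / (\<Prod>j=1..d-k. s - of_nat j) else pochhammer s (k - d)) meromorphic_on A"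
      by (cases "k \<le> d") (auto simp: pochhammer_prod intro!: meromorphic_intros)
    ultimately show ?thesis
      unfolding barnes_pole_term_def by (intro meromorphic_on_mult)
  qed
  have "(\<lambda>s. rGamma s * (LINT t:{0<..}|lborel. barnes_integrand d N a w s t)) holomorphic_on
      {s. Re s > real d - real N}"
    by (intro holomorphic_intros holomorphic_barnes_integral holomorphic_rGamma assms)
  hence "(\<lambda>s. rGamma s * (LINT t:{0<..}|lborel. barnes_integrand d N a w s t)) meromorphic_on
      {s. Re s > real d - real N}"
    by (intro analytic_on_imp_meromorphic_on) (simp add: analytic_on_open open_halfspace_Re_gt)
  thus ?thesis
    unfolding barnes_continuation_def
    by (rule meromorphic_on_add) (intro meromorphic_intros pole_term)
qed

text \<open>Raising the index by one moves a Taylor term from the integral into the sum, so all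
  continuations agree where the smaller index is valid.\<close>

lemma barnes_continuation_mono:
  assumes "d \<ge> 1" "Re a > 0" "\<And>i. i \<in> {1..d} \<Longrightarrow> Re (w i) > 0"
    and "Re s > real d - real N" "N \<le> M"
  shows "barnes_continuation d M a w s = barnes_continuation d N a w s"
  using \<open>N \<le> M\<close>
proof (induction M rule: dec_induct)
  case (step M)
  have s: "Re s > real d - real M" using assms(4) step.hyps by linarith
  have "(LINT t:{0<..}|lborel. barnes_integrand d M a w s t) =
      (LINT t:{0<..}|lborel. barnes_integrand d (Suc M) a w s t) +
      barnes_coeff d w M * (Gamma (s - of_nat d + of_nat M) * a powr (- (s - of_nat d + of_nat M)))"
    by (rule barnes_integral_Suc) (use assms s in auto)
  hence "barnes_continuation d M a w s = barnes_continuation d (Suc M) a w s"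
    unfolding barnes_continuation_def
    using Gamma_quotient_eq_barnes_pole_term[OF s, of a]
    by (simp add: ring_distribs mult.left_commute[of "rGamma s" "barnes_coeff d w M"])
  with step.IH show ?case by simp
qed simp

text \<open>The identity theorem for the difference. Equality holds at poles as well, because a
  nicely meromorphic function is determined at a point by its values nearby.\<close>

lemma nicely_meromorphic_on_eqI:
  assumes f: "f nicely_meromorphic_on A" and g: "g nicely_meromorphic_on A"
    and A: "open A" "connected A"
    and z0: "z0 \<in> A" and eq: "eventually (\<lambda>z. f z = g z) (at z0)" and z: "z \<in> A"
  shows "f z = g z"
proof -
  \<comment> \<open>The difference need not be nicely meromorphic, for instance where poles cancel;
    hence the detour through \<open>remove_sings\<close>.\<close>
  define h where "h = (\<lambda>z. f z - g z)"
  have h: "h meromorphic_on A"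
    using f g unfolding h_def nicely_meromorphic_on_def by (auto intro!: meromorphic_intros)
  have ev: "eventually (\<lambda>u. remove_sings h u = h u) (at u)" if "u \<in> A" for u
    using h that meromorphic_on_isolated_singularity meromorphic_on_subset
    by (intro eventually_remove_sings_eq_at) blast
  have "eventually (\<lambda>u. remove_sings h u = 0) (at z0)"
    using eq ev[OF z0] by eventually_elim (simp add: h_def)
  hence "frequently (\<lambda>u. remove_sings h u = 0) (at z0)"
    by (intro eventually_frequently) auto
  from frequently_eq_meromorphic_imp_constant[OF this remove_sings_nicely_meromorphic[OF h] A z0]
  have "remove_sings h u = 0" if "u \<in> A" for u using that by blast
  moreover have "eventually (\<lambda>u. u \<in> A) (at z)"
    using A z by (intro eventually_at_in_open') auto
  ultimately have "eventually (\<lambda>u. f u = g u) (at z)"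
    using ev[OF z] by (auto elim: eventually_elim2 simp: h_def)
  hence "remove_sings f z = remove_sings g z" by (rule remove_sings_cong) simp
  moreover have "remove_sings F z = F z" if "F nicely_meromorphic_on A" for F
    using that z unfolding nicely_meromorphic_on_def by auto
  ultimately show ?thesis using f g by simp
qed

text \<open>Resolves the definite description in \<open>barnes_zeta\<close>: gluing the
  continuations and removing singularities gives existence, the identity theorem gives uniqueness.
  Equality is claimed near \<open>z\<close> only, since values at singularities are
  normalised.\<close>

lemma eventually_barnes_zeta_eq:
  assumes "d \<ge> 1" "Re a > 0" "\<And>i. i \<in> {1..d} \<Longrightarrow> Re (w i) > 0"
    and z: "Re z > real d - real N"
  shows "eventually (\<lambda>s. barnes_zeta d s a w = barnes_continuation d N a w s) (at z)"
proof -
  \<comment> \<open>An index exceeding \<open>d - Re s\<close>, so that \<open>s\<close> lies in the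
    half-plane of its continuation. \<open>F\<close> uses a different index at different points,
    which is consistent by \<open>barnes_continuation_mono\<close>.\<close>
  define n where "n s = Suc (nat \<lfloor>real d - Re s\<rfloor>)" for s
  define F where "F s = barnes_continuation d (n s) a w s" for s
  have n: "Re s > real d - real (n s)" for s
    unfolding n_def by linarith
  have F_eq: "F s = barnes_continuation d M a w s" if "Re s > real d - real M" for s M
    using barnes_continuation_mono[of d a w "n s" s M] barnes_continuation_mono[of d a w M s "n s"]
      assms(1-3) n that
    by (cases "n s \<le> M") (auto simp: F_def)
  have ev_F: "eventually (\<lambda>s. F s = barnes_continuation d M a w s) (at u)"
    if "Re u > real d - real M" for u M
  proof -
    have "eventually (\<lambda>s. s \<in> {s. Re s > real d - real M}) (at u)"
      using that by (intro eventually_at_in_open') (auto simp: open_halfspace_Re_gt)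
    thus ?thesis by eventually_elim (use F_eq in auto)
  qed
  have F_mero: "F meromorphic_on UNIV"
  proof (subst meromorphic_on_meromorphic_at, intro ballI)
    fix u
    have "barnes_continuation d (n u) a w meromorphic_on {u}"
      by (rule meromorphic_on_subset[OF meromorphic_barnes_continuation]) (use assms n in auto)
    also have "?this \<longleftrightarrow> F meromorphic_on {u}"
      using ev_F[OF n[of u]] by (intro meromorphic_on_cong) (auto elim: eventually_mono)
    finally show "F meromorphic_on {u}" .
  qed
  define Z where "Z = remove_sings F"
  have Z: "Z nicely_meromorphic_on UNIV"
    unfolding Z_def by (rule remove_sings_nicely_meromorphic[OF F_mero])
  have Z_series: "Z s = barnes_series d s a w" if "Re s > real d" for s
  proof -
    define H where "H = {s. Re s > real d - real 0}"
    have H: "open H" "s \<in> H" using that by (auto simp: H_def open_halfspace_Re_gt)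
    \<comment> \<open>At index 0 the sum of pole terms is empty, so \<open>F\<close> is holomorphic
      here and \<open>remove_sings\<close> leaves its values unchanged.\<close>
    have "(\<lambda>s. rGamma s * (LINT t:{0<..}|lborel. barnes_integrand d 0 a w s t)) holomorphic_on H"
      unfolding H_def by (intro holomorphic_intros holomorphic_barnes_integral holomorphic_rGamma assms)
    hence "F holomorphic_on H"
      by (rule holomorphic_transform) (use F_eq[of 0] in \<open>auto simp: H_def barnes_continuation_def\<close>)
    hence "F analytic_on {s}" using H by (auto simp: analytic_at)
    hence "Z s = F s" by (simp add: Z_def)
    also have "\<dots> = barnes_series d s a w"
      using F_eq[of 0 s] barnes_series_eq_integral[of d a w s] assms(1-3) that
      by (simp add: barnes_continuation_def)
    finally show ?thesis .
  qed
  have "barnes_zeta d s a w = Z s" for s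
  proof -
    have "(THE f. f nicely_meromorphic_on UNIV \<and> (\<forall>s. Re s > real d \<longrightarrow> f s = barnes_series d s a w)) = Z"
    proof (rule the_equality)
      fix f assume f: "f nicely_meromorphic_on UNIV \<and> (\<forall>s. Re s > real d \<longrightarrow> f s = barnes_series d s a w)"
      \<comment> \<open>The point \<open>d + 1\<close> serves as a starting point for the identity
        theorem: near it both functions equal the series.\<close>
      have "eventually (\<lambda>s. s \<in> {s. Re s > real d}) (at (of_nat (Suc d)))"
        by (intro eventually_at_in_open') (auto simp: open_halfspace_Re_gt)
      hence "eventually (\<lambda>s. f s = Z s) (at (of_nat (Suc d)))"
        by eventually_elim (use f Z_series in auto)
      thus "f = Z"
        using nicely_meromorphic_on_eqI[of f UNIV Z] f Z by auto
    qed (use Z Z_series in auto)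
    thus ?thesis by (simp add: barnes_zeta_def)
  qed
  moreover have "eventually (\<lambda>s. Z s = F s) (at z)"
    unfolding Z_def using F_mero
    by (intro eventually_remove_sings_eq_at) (auto intro: meromorphic_on_isolated_singularity meromorphic_on_subset)
  ultimately show ?thesis
    using ev_F[OF z] by (auto elim: eventually_elim2)
qed

section \<open>Finite part at a simple pole\<close>

lemma finite_part_eq_deriv:
  assumes h: "h analytic_on {q}" and eq: "eventually (\<lambda>s. f s = h s / (s - q)) (at q)"
  shows "finite_part f q = deriv h q"
proof -
  let ?H = "fps_to_fls (fps_expansion h q)"
  \<comment> \<open>Dividing by \<open>s - q\<close> shifts the Taylor series of \<open>h\<close>
    down by one degree, so the constant term is its linear coefficient.\<close>
  have "(\<lambda>z. inverse z * h (q + z)) has_laurent_expansion fls_X_inv * ?H"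
    by (intro laurent_expansion_intros has_laurent_expansion_fps analytic_at_imp_has_fps_expansion h)
  moreover have "eventually (\<lambda>z. inverse z * h (q + z) = f (q + z)) (at 0)"
    using eq by (subst (asm) at_to_0) (auto simp: eventually_filtermap field_simps elim!: eventually_mono)
  ultimately have "(\<lambda>z. f (q + z)) has_laurent_expansion fls_X_inv * ?H"
    by (subst (asm) has_laurent_expansion_cong) auto
  hence "laurent_expansion f q = fls_X_inv * ?H" by (rule laurent_expansion_eqI)
  thus ?thesis
    by (simp add: finite_part_def fls_X_inv_times_conv_shift fps_expansion_def)
qed

text \<open>The indices below \<open>q\<close> contribute the harmonic number and factorial of
  \<open>q - 1\<close>; those above contribute the ones of \<open>m\<close>, with negative
  differences.\<close>

lemma punctured_sum_and_prod:
  fixes q m :: nat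
  assumes "q \<ge> 1"
  shows "(\<Sum>j\<in>{1..q+m}-{q}. 1 / (of_nat q - of_nat j :: complex)) = harm (q - 1) - harm m"
    and "(\<Prod>j\<in>{1..q+m}-{q}. of_nat q - of_nat j :: complex) = fact (q - 1) * ((-1) ^ m * fact m)"
proof -
  have split: "{1..q+m}-{q} = {1..<q} \<union> {q+1..q+m}" "{1..<q} \<inter> {q+1..q+m} = {}"
    using assms by auto
  have "(\<Sum>j\<in>{1..<q}. 1 / (of_nat q - of_nat j :: complex)) = harm (q - 1)"
    unfolding harm_def
    by (rule sum.reindex_bij_witness[of _ "\<lambda>j. q - j" "\<lambda>j. q - j"]) (auto simp: of_nat_diff divide_simps)
  moreover have "(\<Sum>j\<in>{q+1..q+m}. 1 / (of_nat q - of_nat j :: complex)) = - harm m"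
    unfolding harm_def sum_negf[symmetric]
    by (rule sum.reindex_bij_witness[of _ "\<lambda>j. q + j" "\<lambda>j. j - q"]) (auto simp: of_nat_diff divide_simps)
  ultimately show "(\<Sum>j\<in>{1..q+m}-{q}. 1 / (of_nat q - of_nat j :: complex)) = harm (q - 1) - harm m"
    unfolding split(1) by (subst sum.union_disjoint) (use split(2) in auto)
  have "(\<Prod>j\<in>{1..<q}. of_nat q - of_nat j :: complex) = fact (q - 1)"
    unfolding fact_prod of_nat_prod
    by (rule prod.reindex_bij_witness[of _ "\<lambda>j. q - j" "\<lambda>j. q - j"]) (auto simp: of_nat_diff)
  moreover have "(\<Prod>j\<in>{q+1..q+m}. of_nat q - of_nat j :: complex) = (\<Prod>j=1..m. - of_nat j)"
    by (rule prod.reindex_bij_witness[of _ "\<lambda>j. q + j" "\<lambda>j. j - q"]) (auto simp: of_nat_diff)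
  moreover have "(\<Prod>j=1..m. - of_nat j :: complex) = (-1) ^ m * fact m"
    by (induction m) (auto simp: algebra_simps)
  ultimately show "(\<Prod>j\<in>{1..q+m}-{q}. of_nat q - of_nat j :: complex) = fact (q - 1) * ((-1) ^ m * fact m)"
    unfolding split(1) by (subst prod.union_disjoint) (use split(2) in auto)
qed

text \<open>The value at \<open>q\<close> times the logarithmic derivative: the power contributes
  \<open>- ln a\<close>, the product in the denominator minus the sum of
  \<open>punctured_sum_and_prod\<close>.\<close>

lemma has_field_derivative_powr_over_prod:
  fixes a :: complex
  assumes "a \<noteq> 0" "q \<ge> 1"
  shows "((\<lambda>s. a powr (of_nat (q + m) - s) / (\<Prod>j\<in>{1..q+m}-{q}. s - of_nat j)) has_field_derivative
     (-1) ^ m * a ^ m / (fact (q - 1) * fact m) * (harm m - harm (q - 1) - ln a)) (at (of_nat q))"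
proof -
  let ?J = "{1..q+m}-{q}"
  define P :: "complex \<Rightarrow> complex" where "P s = (\<Prod>j\<in>?J. s - of_nat j)" for s
  define S :: complex where "S = (\<Sum>j\<in>?J. 1 / (of_nat q - of_nat j))"
  have P: "(P has_field_derivative P (of_nat q) * S) (at (of_nat q))"
    unfolding P_def S_def
    by (rule has_field_derivative_prod') (auto intro!: derivative_eq_intros)
  have Pq: "P (of_nat q) = fact (q - 1) * ((-1) ^ m * fact m)" and S: "S = harm (q - 1) - harm m"
    unfolding P_def S_def by (intro punctured_sum_and_prod assms)+
  have P0: "P (of_nat q) \<noteq> 0" by (simp add: Pq)
  have E: "((\<lambda>s. a powr (of_nat (q + m) - s)) has_field_derivative
      Ln a * a powr (of_nat (q + m) - of_nat q) * (-1)) (at (of_nat q))"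
    by (rule DERIV_chain2[OF has_field_derivative_powr_right[OF assms(1)]])
       (auto intro!: derivative_eq_intros)
  have am: "a powr (of_nat (q + m) - of_nat q) = a ^ m"
    using assms(1) by (simp add: powr_nat')
  have "((\<lambda>s. a powr (of_nat (q + m) - s) / P s) has_field_derivative
      (Ln a * a ^ m * (-1) * P (of_nat q) - a ^ m * (P (of_nat q) * S)) / (P (of_nat q) * P (of_nat q))) (at (of_nat q))"
    using DERIV_divide[OF E P P0] unfolding am .
  also have "(Ln a * a ^ m * (-1) * P (of_nat q) - a ^ m * (P (of_nat q) * S)) / (P (of_nat q) * P (of_nat q)) =
      a ^ m / P (of_nat q) * (- S - Ln a)"
    using P0 by (simp add: field_simps)
  also have "\<dots> = (-1) ^ m * a ^ m / (fact (q - 1) * fact m) * (harm m - harm (q - 1) - ln a)"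
    unfolding Pq S by (cases "even m") (simp_all add: field_simps)
  finally show ?thesis by (simp add: P_def)
qed

theorem mainTheorem9:
  fixes d q :: nat and a :: complex and w :: "nat \<Rightarrow> complex"
  assumes "d \<ge> 1"
    and "Re a > 0"
    and "\<And>i. i \<in> {1..d} \<Longrightarrow> Re (w i) > 0"
    and "q \<in> {1..d}"
  shows "finite_part (\<lambda>\<alpha>. barnes_zeta d \<alpha> a w) (of_nat q) =
    barnes_I d (d - q) (of_nat q) a w +
    (-1) ^ (d - q) / ((\<Prod>i=1..d. w i) * fact (q - 1)) *
    (\<Sum>k=0..d-q. a ^ (d - q - k) * bernoulli_num_ho d k w / (fact k * fact (d - q - k)) *
       (harm (d - q - k) - harm (q - 1) - ln a))"
proof -
  have a0: "a \<noteq> 0" using assms(2) by auto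
  have q: "q \<ge> 1" "q \<le> d" using assms(4) by auto
  define I where "I s = barnes_I d (d - q) s a w" for s
  \<comment> \<open>\<open>U k\<close> is \<open>s - q\<close> times the pole term of index
    \<open>k\<close>, with the factor \<open>s - q\<close> cancelled; \<open>D k\<close> below is
    its derivative at \<open>q\<close>.\<close>
  define U where "U k s = a powr (of_nat (d - k) - s) / (\<Prod>j\<in>{1..d-k}-{q}. s - of_nat j)" for k s
  define h where "h s = (s - of_nat q) * I s + (\<Sum>k=0..d-q. barnes_coeff d w k * U k s)" for s
  define D where "D k = (-1) ^ (d - q - k) * a ^ (d - q - k) / (fact (q - 1) * fact (d - q - k)) *
      (harm (d - q - k) - harm (q - 1) - ln a)" for k
  \<comment> \<open>This is the half-plane \<open>Re s > q - 1\<close>, which contains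
    \<open>q\<close>.\<close>
  define H where "H = {s. Re s > real d - real (Suc (d - q))}"
  have H: "open H" "of_nat q \<in> H" using q by (auto simp: H_def open_halfspace_Re_gt)
  have I_eq: "I s = rGamma s * (LINT t:{0<..}|lborel. barnes_integrand d (Suc (d - q)) a w s t)" for s
    unfolding I_def by (rule barnes_I_eq) (use assms in auto)
  have I_hol: "I holomorphic_on H"
    unfolding I_eq[abs_def] H_def
    by (intro holomorphic_intros holomorphic_barnes_integral holomorphic_rGamma assms)
  \<comment> \<open>The remaining factors of the denominators vanish only at the other integers in
    \<open>{1..d}\<close>; removing these leaves an open neighbourhood of \<open>q\<close>.\<close>
  have "h holomorphic_on (H - of_nat ` ({1..d} - {q}))"
    unfolding h_def U_def
    by (intro holomorphic_intros holomorphic_on_subset[OF I_hol]) (use a0 in auto)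
  moreover have "open (H - of_nat ` ({1..d} - {q}) :: complex set)"
    using H by (intro open_Diff finite_imp_closed) auto
  moreover have "of_nat q \<in> H - of_nat ` ({1..d} - {q})" using H by auto
  ultimately have h_analytic: "h analytic_on {of_nat q}"
    unfolding analytic_at by blast
  have "(I has_field_derivative deriv I (of_nat q)) (at (of_nat q))"
    using holomorphic_derivI[OF I_hol H] .
  \<comment> \<open>The factor \<open>s - q\<close> vanishes at \<open>q\<close>, so only the value
    of \<open>I\<close> survives in the product rule.\<close>
  hence I_deriv: "((\<lambda>s. (s - of_nat q) * I s) has_field_derivative I (of_nat q)) (at (of_nat q))"
    by (auto intro!: derivative_eq_intros)
  have U_deriv: "(U k has_field_derivative D k) (at (of_nat q))" if "k \<le> d - q" for k
  proof -
    have "d - k = q + (d - q - k)" using that q by simp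
    thus ?thesis
      using has_field_derivative_powr_over_prod[OF a0 q(1), of "d - q - k"]
      unfolding U_def D_def by simp
  qed
  have "(h has_field_derivative I (of_nat q) + (\<Sum>k=0..d-q. barnes_coeff d w k * D k)) (at (of_nat q))"
    unfolding h_def by (intro DERIV_add I_deriv DERIV_sum DERIV_cmult U_deriv) auto
  hence h_deriv: "deriv h (of_nat q) = I (of_nat q) + (\<Sum>k=0..d-q. barnes_coeff d w k * D k)"
    by (rule DERIV_imp_deriv)
  have "eventually (\<lambda>s. barnes_zeta d s a w = barnes_continuation d (Suc (d - q)) a w s) (at (of_nat q))"
    by (rule eventually_barnes_zeta_eq) (use assms q in auto)
  moreover have "eventually (\<lambda>s. s \<noteq> of_nat q) (at (of_nat q :: complex))"
    by (rule eventually_at_filter[THEN iffD2]) auto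
  ultimately have "eventually (\<lambda>s. barnes_zeta d s a w = h s / (s - of_nat q)) (at (of_nat q))"
  proof eventually_elim
    case (elim s)
    \<comment> \<open>For \<open>k \<le> d - q\<close> the product over \<open>{1..d-k}\<close>
      contains the factor \<open>s - q\<close>, so every split-off term fits the form
      \<open>U k s / (s - q)\<close>.\<close>
    have "barnes_pole_term d k a s = U k s / (s - of_nat q)" if k: "k \<le> d - q" for k
    proof -
      have "q \<in> {1..d-k}" using k q by auto
      hence "(\<Prod>j=1..d-k. s - of_nat j) = (s - of_nat q) * (\<Prod>j\<in>{1..d-k}-{q}. s - of_nat j)"
        by (intro prod.remove) auto
      moreover have "k \<le> d" using k by simp
      ultimately show ?thesis
        unfolding barnes_pole_term_def U_def by (simp add: of_nat_diff mult.commute)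
    qed
    hence "barnes_continuation d (Suc (d - q)) a w s = I s + (\<Sum>k=0..d-q. barnes_coeff d w k * (U k s / (s - of_nat q)))"
      unfolding barnes_continuation_def I_eq lessThan_Suc_atMost atMost_atLeast0
      by simp
    also have "\<dots> = h s / (s - of_nat q)"
      using elim by (simp add: h_def add_divide_distrib sum_divide_distrib)
    finally show ?case using elim by simp
  qed
  hence "finite_part (\<lambda>\<alpha>. barnes_zeta d \<alpha> a w) (of_nat q) = I (of_nat q) + (\<Sum>k=0..d-q. barnes_coeff d w k * D k)"
    using finite_part_eq_deriv[OF h_analytic] h_deriv by simp
  also have "(\<Sum>k=0..d-q. barnes_coeff d w k * D k) = (-1) ^ (d - q) / ((\<Prod>i=1..d. w i) * fact (q - 1)) *
    (\<Sum>k=0..d-q. a ^ (d - q - k) * bernoulli_num_ho d k w / (fact k * fact (d - q - k)) *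
       (harm (d - q - k) - harm (q - 1) - ln a))"
    unfolding sum_distrib_left
  proof (intro sum.cong refl)
    fix k assume "k \<in> {0..d-q}"
    \<comment> \<open>The sign of \<open>barnes_coeff\<close> and the sign from the factors with
      index above \<open>q\<close> combine to one independent of \<open>k\<close>.\<close>
    hence "k + (d - q - k) = d - q" by simp
    hence "(-1) ^ (d - q) = (-1) ^ k * (-1 :: complex) ^ (d - q - k)"
      by (metis power_add)
    thus "barnes_coeff d w k * D k = (-1) ^ (d - q) / ((\<Prod>i=1..d. w i) * fact (q - 1)) *
      (a ^ (d - q - k) * bernoulli_num_ho d k w / (fact k * fact (d - q - k)) *
       (harm (d - q - k) - harm (q - 1) - ln a))"
      by (simp add: barnes_coeff_def D_def mult_ac)
  qed
  finally show ?thesis by (simp add: I_def)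
qed

end
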